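(* Let $A$ be a separable C*-algebra and let $h\in A$ be a strictly positive element. Let $(a_\lambda)_{\lambda\in\Lambda}$ be a norm-bounded net in $A$. Then $(a_\lambda)_{\lambda\in\Lambda}$ converges to $0$ in the weakly-uniform topology $\mathrm{wu}$ if and only if $\lim_{\lambda\in\Lambda}\|ha_\lambda h\|=0$. Equivalently, on any norm-bounded set $B\subseteq A$, the distance $\Delta(a,b)=\|h(b-a)h\|$ ($a,b\in B$) metrizes the (restriction to $B$ of the) topology $\mathrm{wu}$.
   Context: $S(A)$ is the state space of $A$ with the weak* topology. For each weak* compact subset $K$ of $S(A)$ let $p_K(a)=\sup_{\varphi\in K}|\varphi(a)|$ for $a\in A$. The weakly-uniform topology $\mathrm{wu}$ is the locally convex topology on $A$ generated by all the seminorms $p_K$, $K$ ranging over the weak* compact subsets of $S(A)$. A strictly positive element of $A$ is a positive $h\in A$ with $\varphi(h)>0$ for every state $\varphi$ of $A$. *)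

theory Defs
  imports "HOL-Analysis.Analysis" "HOL-Library.Complex_Order"
begin

section \<open>C*-algebras\<close>

text \<open>
  C*-algebras as a type class, not assumed to be unital. Norm, metric and real scalar
  multiplication are those of \<^class>\<open>real_normed_algebra\<close> and \<^class>\<open>banach\<close>; the complex scalar
  multiplication extends the real one.
\<close>

class scaleC = scaleR +
  fixes scaleC :: "complex \<Rightarrow> 'a \<Rightarrow> 'a" (infixr "*\<^sub>C" 75)
  assumes scaleR_scaleC: "r *\<^sub>R x = complex_of_real r *\<^sub>C x"

class complex_banach_algebra = scaleC + real_normed_algebra + banach +
  assumes scaleC_add_right: "c *\<^sub>C (x + y) = c *\<^sub>C x + c *\<^sub>C y"
    and scaleC_add_left: "(c + d) *\<^sub>C x = c *\<^sub>C x + d *\<^sub>C x"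
    and scaleC_scaleC: "c *\<^sub>C (d *\<^sub>C x) = (c * d) *\<^sub>C x"
    and norm_scaleC: "norm (c *\<^sub>C x) = cmod c * norm x"
    and mult_scaleC_left: "(c *\<^sub>C x) * y = c *\<^sub>C (x * y)"
    and mult_scaleC_right: "x * (c *\<^sub>C y) = c *\<^sub>C (x * y)"

class cstar_algebra = complex_banach_algebra +
  fixes star :: "'a \<Rightarrow> 'a"
  assumes star_star: "star (star x) = x"
    and star_add: "star (x + y) = star x + star y"
    and star_scaleC: "star (c *\<^sub>C x) = cnj c *\<^sub>C star x"
    and star_mult: "star (x * y) = star y * star x"
    and cstar_identity: "norm (star x * x) = (norm x)\<^sup>2"

definition positive_element :: "'a::cstar_algebra \<Rightarrow> bool" where
  "positive_element a \<longleftrightarrow> (\<exists>b. a = star b * b)"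


section \<open>States\<close>

text \<open>
  The order on \<^typ>\<open>complex\<close> is the one of \<^theory>\<open>HOL-Library.Complex_Order\<close>: \<open>0 \<le> z\<close>
  (respectively \<open>0 < z\<close>) says that \<open>z\<close> is real and nonnegative (respectively positive).
\<close>

definition states :: "('a::cstar_algebra \<Rightarrow> complex) set" where
  "states = {\<phi>. bounded_linear \<phi> \<and> (\<forall>c x. \<phi> (c *\<^sub>C x) = c * \<phi> x) \<and>
                (\<forall>x. 0 \<le> \<phi> (star x * x)) \<and> onorm \<phi> = 1}"

text \<open>The weak* topology on states is the topology of pointwise convergence.\<close>

definition state_space :: "('a::cstar_algebra \<Rightarrow> complex) topology" where
  "state_space = subtopology (product_topology (\<lambda>_. euclidean) UNIV) states"

definition strictly_positive :: "'a::cstar_algebra \<Rightarrow> bool" where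
  "strictly_positive h \<longleftrightarrow> positive_element h \<and> (\<forall>\<phi>\<in>states. 0 < \<phi> h)"


section \<open>The weakly-uniform topology\<close>

text \<open>The supremum over the empty set of states is \<open>0\<close> (\<^term>\<open>Sup {} :: real\<close> is unspecified).\<close>

definition sup_seminorm :: "('a::cstar_algebra \<Rightarrow> complex) set \<Rightarrow> 'a \<Rightarrow> real" where
  "sup_seminorm K a = (if K = {} then 0 else (SUP \<phi>\<in>K. cmod (\<phi> a)))"

text \<open>The \<open>insert UNIV\<close> only matters for an empty family of seminorms.\<close>

definition seminorm_topology :: "('a::real_vector \<Rightarrow> real) set \<Rightarrow> 'a topology" where
  "seminorm_topology P =
     topology_generated_by (insert UNIV {{y. p (y - x) < e} | p x e. p \<in> P \<and> 0 < e})"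

definition wu_topology :: "'a::cstar_algebra topology" where
  "wu_topology = seminorm_topology {sup_seminorm K | K. compactin state_space K}"


section \<open>Nets\<close>

definition directed_set :: "'l set \<Rightarrow> ('l \<Rightarrow> 'l \<Rightarrow> bool) \<Rightarrow> bool" where
  "directed_set \<Lambda> le \<longleftrightarrow> \<Lambda> \<noteq> {} \<and> reflp_on \<Lambda> le \<and> transp_on \<Lambda> le \<and>
     (\<forall>i\<in>\<Lambda>. \<forall>j\<in>\<Lambda>. \<exists>k\<in>\<Lambda>. le i k \<and> le j k)"

definition net_filter :: "'l set \<Rightarrow> ('l \<Rightarrow> 'l \<Rightarrow> bool) \<Rightarrow> 'l filter" where
  "net_filter \<Lambda> le = (INF i\<in>\<Lambda>. principal {j\<in>\<Lambda>. le i j})"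

lemma eventually_net_filter:
  assumes "directed_set \<Lambda> le"
  shows "eventually P (net_filter \<Lambda> le) \<longleftrightarrow> (\<exists>i\<in>\<Lambda>. \<forall>j\<in>\<Lambda>. le i j \<longrightarrow> P j)"
proof -
  have ne: "\<Lambda> \<noteq> {}"
    using assms by (simp add: directed_set_def)
  have base: "\<exists>k\<in>\<Lambda>. principal {l\<in>\<Lambda>. le k l} \<le> inf (principal {l\<in>\<Lambda>. le i l}) (principal {l\<in>\<Lambda>. le j l})"
    if "i \<in> \<Lambda>" "j \<in> \<Lambda>" for i j
  proof -
    from assms that obtain k where k: "k \<in> \<Lambda>" "le i k" "le j k"
      unfolding directed_set_def by meson
    have tr: "transp_on \<Lambda> le"
      using assms by (simp add: directed_set_def)
    have "le i l" "le j l" if "l \<in> \<Lambda>" "le k l" for l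
      using transp_onD[OF tr \<open>i \<in> \<Lambda>\<close> k(1) that(1) k(2) that(2)]
        transp_onD[OF tr \<open>j \<in> \<Lambda>\<close> k(1) that(1) k(3) that(2)] .
    then have "{l\<in>\<Lambda>. le k l} \<subseteq> {l\<in>\<Lambda>. le i l} \<inter> {l\<in>\<Lambda>. le j l}"
      by blast
    then have "principal {l\<in>\<Lambda>. le k l} \<le> inf (principal {l\<in>\<Lambda>. le i l}) (principal {l\<in>\<Lambda>. le j l})"
      unfolding inf_principal principal_le_iff .
    with k(1) show ?thesis by (rule bexI[rotated])
  qed
  have "eventually P (net_filter \<Lambda> le) \<longleftrightarrow> (\<exists>i\<in>\<Lambda>. eventually P (principal {j\<in>\<Lambda>. le i j}))"
    unfolding net_filter_def by (rule eventually_INF_base[OF ne]) (rule base)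
  then show ?thesis
    unfolding eventually_principal mem_Collect_eq Ball_def imp_conjL .
qed

end

theory Submission
  imports Defs
begin

text \<open>
  Write \<open>A\<close> for the algebra, let \<open>c = 1 / (1 + \<parallel>h\<parallel>)\<close>, and put \<open>v\<^sub>n = (1 - c h)\<^sup>n\<close> in the
  unitization of \<open>A\<close>. These elements decrease, lie between \<open>0\<close> and \<open>1\<close>, and satisfy
  \<open>\<parallel>h v\<^sub>n\<parallel> \<le> (1 + \<parallel>h\<parallel>) / (n + 1)\<close>; moreover \<open>1 - v\<^sub>n\<close> is a multiple of \<open>h\<close> from either side.
  The two estimates behind the theorem, both for \<open>a\<close> in a bounded set, are as follows.

  If \<open>\<parallel>h a h\<parallel>\<close> is small, so is \<open>p\<^sub>K(a)\<close> (\<open>sup_seminorm_small_if_compression_small\<close>). For a state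
  \<open>\<phi>\<close> the numbers \<open>\<phi>(v\<^sub>n)\<close> decrease to \<open>0\<close> (\<open>unit_defect_tendsto_zero\<close>): because they converge, the
  functionals \<open>a \<mapsto> \<phi>(v\<^sub>n a v\<^sub>n)\<close> converge pointwise to a positive functional; it kills \<open>h\<close>, hence is
  zero by strict positivity, and this forces \<open>\<phi>\<close> to have its whole mass on \<open>1 - v\<^sub>n\<close> in the limit.
  By Dini's argument the convergence is uniform on a compact set \<open>K\<close> of states
  (\<open>unit_defect_uniformly_small\<close>). The Cauchy-Schwarz inequality then makes \<open>\<phi>(a)\<close> uniformly close
  to \<open>\<phi>((1 - v\<^sub>n) a (1 - v\<^sub>n))\<close>, and this is at most \<open>n\<^sup>2 \<parallel>h a h\<parallel>\<close>
  (\<open>quasi_state_le_unit_sandwich\<close>).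

  Conversely, a single pair \<open>K, \<delta>\<close> makes \<open>\<parallel>h a h\<parallel>\<close> small
  (\<open>compression_small_if_sup_seminorm_small\<close>). Up to a factor \<open>2\<close> the norm of \<open>h a h\<close> is the supremum
  of \<open>\<bar>\<phi>(h a h)\<bar>\<close> over the compact set of positive functionals of norm at most \<open>1\<close>. Those with
  \<open>\<phi>(h\<^sup>2) < \<epsilon>\<close> contribute at most \<open>\<epsilon> \<parallel>a\<parallel>\<close>. The others form a compact set, and its image under
  \<open>\<phi> \<mapsto> \<phi>(h \<cdot> h) / \<phi>(h\<^sup>2)\<close> is a compact set \<open>K\<close> of states, so they contribute at most
  \<open>\<parallel>h\<parallel>\<^sup>2 p\<^sub>K(a)\<close>.

  The C*-algebraic facts used here are proved without spectra. An element of a unital C*-algebra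
  is called nonnegative if it is the square of a self-adjoint one; the binomial series of
  \<open>sqrt (1 - x)\<close> shows that this is a condition on norms (\<open>nonneg_iff_norm\<close>), from which the cone
  properties and the monotonicity of the norm follow. That \<open>star a * a\<close> is nonnegative is Kaplansky's
  argument (\<open>nonneg_star_mult_self\<close>). Functionals that attain the norm of a self-adjoint element come
  from the Hahn-Banach theorem for the sublinear functional \<open>y \<mapsto> inf\<^sub>r (\<parallel>r + y\<parallel> - r)\<close>
  (\<open>exists_norming_quasi_state\<close>).
\<close>

section \<open>Elementary facts on C*-algebras\<close>

lemma scaleC_zero_left [simp]:
  fixes x :: "'a::cstar_algebra"
  shows "0 *\<^sub>C x = 0"
  using scaleR_scaleC[of 0 x] by simp

lemma scaleC_one [simp]:
  fixes x :: "'a::cstar_algebra"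
  shows "1 *\<^sub>C x = x"
  using scaleR_scaleC[of 1 x] by simp

lemma scaleC_zero_right [simp]: "c *\<^sub>C 0 = (0::'a::cstar_algebra)"
  using scaleC_add_right[of c "0::'a" 0] by simp

lemma scaleC_minus_right:
  fixes x :: "'a::cstar_algebra"
  shows "c *\<^sub>C (- x) = - (c *\<^sub>C x)"
  using scaleC_add_right[of c x "- x"] by (simp add: eq_neg_iff_add_eq_0 add.commute)

lemma scaleC_diff_right:
  fixes x y :: "'a::cstar_algebra"
  shows "c *\<^sub>C (x - y) = c *\<^sub>C x - c *\<^sub>C y"
  using scaleC_add_right[of c x "- y"] by (simp add: scaleC_minus_right)

lemma scaleC_minus_left:
  fixes x :: "'a::cstar_algebra"
  shows "(- c) *\<^sub>C x = - (c *\<^sub>C x)"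
  using scaleC_add_left[of c "- c" x] by (simp add: eq_neg_iff_add_eq_0 add.commute)

lemma star_zero [simp]: "star 0 = (0::'a::cstar_algebra)"
  using star_add[of "0::'a" 0] by simp

lemma star_minus:
  fixes x :: "'a::cstar_algebra"
  shows "star (- x) = - star x"
  using star_add[of x "- x"] by (simp add: eq_neg_iff_add_eq_0 add.commute)

lemma star_diff:
  fixes x y :: "'a::cstar_algebra"
  shows "star (x - y) = star x - star y"
  using star_add[of x "- y"] by (simp add: star_minus)

lemma star_scaleR:
  fixes x :: "'a::cstar_algebra"
  shows "star (r *\<^sub>R x) = r *\<^sub>R star x"
  by (simp add: scaleR_scaleC star_scaleC)

lemmas star_simps = star_star star_add star_diff star_minus star_scaleC star_scaleR star_mult

lemma norm_star [simp]: "norm (star x) = norm (x::'a::cstar_algebra)"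
proof -
  have le: "norm y \<le> norm (star y)" for y :: 'a
  proof (cases "y = 0")
    case False
    have "norm y * norm y \<le> norm (star y) * norm y"
      using norm_mult_ineq[of "star y" y] by (simp add: cstar_identity power2_eq_square)
    with False show ?thesis by simp
  qed simp
  show ?thesis using le[of x] le[of "star x"] by (simp add: star_star)
qed

lemma cstar_identity': "norm (x * star x) = (norm (x::'a::cstar_algebra))\<^sup>2"
  using cstar_identity[of "star x"] by (simp add: star_star)

lemma norm_square_selfadjoint: "star t = t \<Longrightarrow> norm (t * t) = (norm (t::'a::cstar_algebra))\<^sup>2"
  using cstar_identity[of t] by simp

lemma bounded_linear_star: "bounded_linear (star :: 'a::cstar_algebra \<Rightarrow> 'a)"
  by (rule bounded_linear_intro[of _ 1]) (simp_all add: star_add star_scaleR)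

lemma scaleC_ii_ii [simp]: "\<i> *\<^sub>C \<i> *\<^sub>C x = - (x::'a::cstar_algebra)"
  by (simp add: scaleC_scaleC scaleC_minus_left)

lemma cartesian_decomposition:
  fixes a :: "'a::cstar_algebra"
  obtains c d where "star c = c" "star d = d" "a = c + \<i> *\<^sub>C d"
proof
  let ?c = "(1/2) *\<^sub>R (a + star a)" and ?d = "(1/2) *\<^sub>R (\<i> *\<^sub>C (star a - a))"
  show "star ?c = ?c" by (simp add: star_simps add.commute)
  show "star ?d = ?d"
    by (simp add: star_simps scaleC_minus_left scaleC_diff_right)
  have "\<i> *\<^sub>C ?d = (1/2) *\<^sub>R (a - star a)"
    by (simp add: scaleR_scaleC scaleC_scaleC scaleC_diff_right scaleC_minus_left)
  then show "a = ?c + \<i> *\<^sub>C ?d"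
    by (simp add: algebra_simps flip: scaleR_add_left)
qed

class unital_cstar_algebra = cstar_algebra + real_normed_algebra_1

lemma star_one [simp]: "star 1 = (1::'a::unital_cstar_algebra)"
  by (metis mult.left_neutral mult.right_neutral star_mult star_star)

lemma star_power: "star (x ^ n) = star (x::'a::unital_cstar_algebra) ^ n"
  by (induction n) (simp_all add: star_mult power_commutes)

section \<open>The unitization\<close>

text \<open>
  The pair \<open>Unit a l\<close> stands for the formal sum \<open>a + l 1\<close>. The norm is the operator norm of
  multiplication by \<open>a + l\<close> on the algebra, combined by a maximum with \<open>\<bar>l\<bar>\<close>. The operator
  norm alone is only a seminorm if the algebra already has a unit \<open>e\<close>, as it vanishes at
  \<open>-e + 1\<close>; with the maximum one construction serves unital and non-unital algebras alike.
\<close>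

datatype 'a unitization = Unit (alg_part: 'a) (scalar_part: complex)

definition unitize :: "'a::zero \<Rightarrow> 'a unitization" where
  "unitize a = Unit a 0"

definition left_action :: "'a::cstar_algebra unitization \<Rightarrow> 'a \<Rightarrow> 'a" where
  "left_action x b = scalar_part x *\<^sub>C b + alg_part x * b"

lemma bounded_linear_left_action: "bounded_linear (left_action x)"
proof (rule bounded_linear_intro)
  fix b
  show "norm (left_action x b) \<le> norm b * (cmod (scalar_part x) + norm (alg_part x))"
    unfolding left_action_def
    by (rule order_trans[OF norm_triangle_ineq])
       (use norm_mult_ineq[of "alg_part x" b] in \<open>simp add: norm_scaleC algebra_simps\<close>)
qed (simp_all add: left_action_def scaleC_add_right algebra_simps scaleR_scaleC scaleC_scaleC
      mult_scaleC_right)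

instantiation unitization :: (cstar_algebra) real_normed_algebra_1
begin

definition "0 = Unit 0 0"
definition "1 = Unit 0 1"
definition "x + y = Unit (alg_part x + alg_part y) (scalar_part x + scalar_part y)"
definition "x - y = Unit (alg_part x - alg_part y) (scalar_part x - scalar_part y)"
definition "- x = Unit (- alg_part x) (- scalar_part x)"
definition "r *\<^sub>R x = Unit (r *\<^sub>R alg_part x) (r *\<^sub>R scalar_part x)"
definition "x * y = Unit (alg_part x * alg_part y + scalar_part x *\<^sub>C alg_part y +
  scalar_part y *\<^sub>C alg_part x) (scalar_part x * scalar_part y)"
definition "norm x = max (cmod (scalar_part x)) (onorm (left_action x))"
definition "sgn (x :: 'a unitization) = inverse (norm x) *\<^sub>R x"
definition "dist (x :: 'a unitization) y = norm (x - y)"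
definition "uniformity = (INF e\<in>{0<..}. principal {(x :: 'a unitization, y). dist x y < e})"
definition "open U \<longleftrightarrow> (\<forall>x\<in>U. \<forall>\<^sub>F (x', y) in uniformity. (x' :: 'a unitization) = x \<longrightarrow> y \<in> U)"

lemmas unitization_defs = zero_unitization_def one_unitization_def plus_unitization_def
  minus_unitization_def uminus_unitization_def scaleR_unitization_def times_unitization_def

lemma left_action_mult: "left_action (x * y) b = left_action x (left_action y b)"
  by (simp add: left_action_def unitization_defs scaleC_add_right scaleC_scaleC algebra_simps
      mult_scaleC_right mult_scaleC_left)

lemma left_action_add: "left_action (x + y) b = left_action x b + left_action y b"
  by (simp add: left_action_def unitization_defs scaleC_add_left algebra_simps)

lemma left_action_scaleR: "left_action (r *\<^sub>R x) b = r *\<^sub>R left_action x b"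
  by (simp add: left_action_def unitization_defs scaleR_scaleC scaleC_add_right scaleC_scaleC algebra_simps
      mult_scaleC_right mult_scaleC_left flip: scaleR_scaleC) (simp add: scaleR_scaleC scaleC_scaleC scaleR_conv_of_real)

text \<open>
  Testing the operator \<open>a + l\<close> on \<open>a\<^sup>*\<close> recovers \<open>\<parallel>a\<parallel>\<close>, by the C*-identity. This gives the
  definiteness and the completeness of the norm on the unitization.
\<close>

lemma norm_alg_part_le: "norm (alg_part x) \<le> onorm (left_action x) + cmod (scalar_part x)"
proof (cases "alg_part x = 0")
  case True
  then show ?thesis using onorm_pos_le[OF bounded_linear_left_action, of x] by simp
next
  case False
  let ?a = "alg_part x" and ?l = "scalar_part x"
  have "(norm ?a)\<^sup>2 = norm (?a * star ?a)" by (simp add: cstar_identity')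
  also have "\<dots> = norm (left_action x (star ?a) - ?l *\<^sub>C star ?a)"
    by (simp add: left_action_def)
  also have "\<dots> \<le> norm (left_action x (star ?a)) + norm (?l *\<^sub>C star ?a)"
    by (rule norm_triangle_ineq4)
  also have "\<dots> \<le> onorm (left_action x) * norm ?a + cmod ?l * norm ?a"
    using onorm[OF bounded_linear_left_action, of x "star ?a"] by (simp add: norm_scaleC)
  finally have "norm ?a * norm ?a \<le> (onorm (left_action x) + cmod ?l) * norm ?a"
    by (simp add: power2_eq_square algebra_simps)
  with False show ?thesis by simp
qed

instance
proof
  fix x y z :: "'a unitization" and r s :: real
  show "x + y + z = x + (y + z)" "x + y = y + x" "0 + x = x" "- x + x = 0" "x - y = x + - y"
    by (simp_all add: unitization_defs add_ac)
  show "r *\<^sub>R (x + y) = r *\<^sub>R x + r *\<^sub>R y" "(r + s) *\<^sub>R x = r *\<^sub>R x + s *\<^sub>R x"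
    "r *\<^sub>R s *\<^sub>R x = (r * s) *\<^sub>R x" "1 *\<^sub>R x = x"
    by (simp_all add: unitization_defs algebra_simps)
  show "x * y * z = x * (y * z)"
    by (simp add: unitization_defs algebra_simps scaleC_add_right scaleC_scaleC
        mult_scaleC_left mult_scaleC_right)
  show "(x + y) * z = x * z + y * z" "x * (y + z) = x * y + x * z"
    by (simp_all add: unitization_defs algebra_simps scaleC_add_right scaleC_add_left)
  show "1 * x = x" "x * 1 = x" "(0::'a unitization) \<noteq> 1"
    by (simp_all add: unitization_defs)
  show "r *\<^sub>R x * y = r *\<^sub>R (x * y)" "x * r *\<^sub>R y = r *\<^sub>R (x * y)"
    by (simp_all add: unitization_defs algebra_simps scaleC_add_right scaleC_scaleC scaleR_scaleC
        mult_scaleC_left mult_scaleC_right scaleR_conv_of_real)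
  show "dist x y = norm (x - y)" by (fact dist_unitization_def)
  show "sgn x = inverse (norm x) *\<^sub>R x" by (fact sgn_unitization_def)
  show "uniformity = (INF e\<in>{0<..}. principal {(x :: 'a unitization, y). dist x y < e})"
    by (fact uniformity_unitization_def)
  show "open U \<longleftrightarrow> (\<forall>x\<in>U. \<forall>\<^sub>F (x', y) in uniformity. (x' :: 'a unitization) = x \<longrightarrow> y \<in> U)" for U
    by (fact open_unitization_def)
  note pos = onorm_pos_le[OF bounded_linear_left_action]
  show "norm x = 0 \<longleftrightarrow> x = 0"
  proof
    assume "norm x = 0"
    then have "cmod (scalar_part x) = 0" "onorm (left_action x) = 0"
      using pos[of x] norm_ge_zero[of "scalar_part x"]
      unfolding norm_unitization_def by linarith+
    then show "x = 0"
      using norm_alg_part_le[of x] by (cases x) (simp add: unitization_defs)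
  next
    assume "x = 0"
    then have "left_action x = (\<lambda>b. 0)"
      by (auto simp: left_action_def unitization_defs)
    then show "norm x = 0"
      using \<open>x = 0\<close> by (simp add: norm_unitization_def onorm_zero) (simp add: unitization_defs)
  qed
  have "onorm (left_action (x + y)) \<le> onorm (left_action x) + onorm (left_action y)"
    using onorm_triangle[OF bounded_linear_left_action[of x] bounded_linear_left_action[of y]]
    by (simp add: left_action_add[abs_def, symmetric])
  moreover have "cmod (scalar_part (x + y)) \<le> cmod (scalar_part x) + cmod (scalar_part y)"
    by (simp add: unitization_defs norm_triangle_ineq)
  ultimately show "norm (x + y) \<le> norm x + norm y"
    unfolding norm_unitization_def by linarith
  have "onorm (left_action (r *\<^sub>R x)) = \<bar>r\<bar> * onorm (left_action x)"
    using onorm_scaleR[OF bounded_linear_left_action[of x], of r]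
    by (simp add: left_action_scaleR[abs_def, symmetric])
  moreover have "cmod (scalar_part (r *\<^sub>R x)) = \<bar>r\<bar> * cmod (scalar_part x)"
    by (simp add: unitization_defs)
  ultimately show "norm (r *\<^sub>R x) = \<bar>r\<bar> * norm x"
    unfolding norm_unitization_def by (simp add: max_mult_distrib_left)
  have "left_action (x * y) = left_action x \<circ> left_action y"
    by (auto simp: left_action_mult)
  then have "onorm (left_action (x * y)) \<le> onorm (left_action x) * onorm (left_action y)"
    using onorm_compose[OF bounded_linear_left_action[of x] bounded_linear_left_action[of y]] by simp
  also have "\<dots> \<le> norm x * norm y"
    unfolding norm_unitization_def by (intro mult_mono) (auto simp: pos le_max_iff_disj)
  finally have 1: "onorm (left_action (x * y)) \<le> norm x * norm y" .
  have "cmod (scalar_part (x * y)) \<le> norm x * norm y"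
    unfolding norm_unitization_def
    by (simp add: times_unitization_def norm_mult) (intro mult_mono; auto simp: pos le_max_iff_disj)
  with 1 show "norm (x * y) \<le> norm x * norm y"
    by (simp add: norm_unitization_def[of "x * y"])
  have "left_action 1 = (\<lambda>b::'a. b)"
    by (auto simp: left_action_def unitization_defs)
  then show "norm (1::'a unitization) = 1"
    using onorm_id_le[where 'a='a] by (simp add: norm_unitization_def one_unitization_def)
qed

end

lemma scalar_part_simps [simp]:
  "scalar_part 0 = 0" "scalar_part 1 = 1" "scalar_part (x + y) = scalar_part x + scalar_part y"
  "scalar_part (x - y) = scalar_part x - scalar_part y" "scalar_part (- x) = - scalar_part x"
  "scalar_part (r *\<^sub>R x) = r *\<^sub>R scalar_part x" "scalar_part (x * y) = scalar_part x * scalar_part y"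
  by (simp_all add: unitization_defs)

lemma onorm_left_action_le_norm: "onorm (left_action x) \<le> norm x"
  by (simp add: norm_unitization_def)

lemma norm_left_action_le: "norm (left_action x b) \<le> norm x * norm b"
  using onorm[OF bounded_linear_left_action, of x b] onorm_left_action_le_norm[of x]
  by (meson mult_right_mono norm_ge_zero order_trans)

lemma norm_scalar_part_le: "cmod (scalar_part x) \<le> norm x"
  by (simp add: norm_unitization_def)

lemma norm_unitize [simp]: "norm (unitize a) = norm (a::'a::cstar_algebra)"
proof (rule antisym)
  have "onorm (left_action (unitize a)) \<le> norm a"
    by (rule onorm_bound) (simp_all add: left_action_def unitize_def norm_mult_ineq)
  then show "norm (unitize a) \<le> norm a"
    by (simp add: norm_unitization_def unitize_def)
  show "norm a \<le> norm (unitize a)"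
    using norm_alg_part_le[of "unitize a"] by (simp add: norm_unitization_def unitize_def)
qed

lemma norm_Unit_le: "norm (Unit a l) \<le> norm a + cmod (l::complex)"
proof -
  have "Unit a l = unitize a + Unit 0 l" by (simp add: unitize_def unitization_defs)
  moreover have "norm (Unit (0::'a) l) \<le> cmod l"
    unfolding norm_unitization_def
    by (auto intro!: onorm_bound simp: left_action_def norm_scaleC)
  ultimately show ?thesis
    using norm_triangle_ineq[of "unitize a" "Unit 0 l"] by simp
qed

instance unitization :: (cstar_algebra) banach
proof
  fix X :: "nat \<Rightarrow> 'a unitization"
  assume X: "Cauchy X"
  have s: "Cauchy (\<lambda>n. scalar_part (X n))"
  proof (rule metric_CauchyI)
    fix e :: real assume "e > 0"
    with X obtain M where "\<forall>m\<ge>M. \<forall>n\<ge>M. dist (X m) (X n) < e" by (meson Cauchy_def)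
    moreover have "dist (scalar_part (X m)) (scalar_part (X n)) \<le> dist (X m) (X n)" for m n
      using norm_scalar_part_le[of "X m - X n"] by (simp add: dist_norm)
    ultimately have "\<forall>m\<ge>M. \<forall>n\<ge>M. dist (scalar_part (X m)) (scalar_part (X n)) < e"
      using le_less_trans by blast
    then show "\<exists>M. \<forall>m\<ge>M. \<forall>n\<ge>M. dist (scalar_part (X m)) (scalar_part (X n)) < e" by blast
  qed
  have le: "norm (alg_part x) \<le> 2 * norm x" for x :: "'a unitization"
    using norm_alg_part_le[of x] by (simp add: norm_unitization_def)
  have a: "Cauchy (\<lambda>n. alg_part (X n))"
  proof (rule metric_CauchyI)
    fix e :: real assume "e > 0"
    with X obtain M where M: "\<forall>m\<ge>M. \<forall>n\<ge>M. dist (X m) (X n) < e/2"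
      by (meson Cauchy_def half_gt_zero)
    have "dist (alg_part (X m)) (alg_part (X n)) < e" if "m \<ge> M" "n \<ge> M" for m n
      using le[of "X m - X n"] M that by (force simp: dist_norm minus_unitization_def)
    then show "\<exists>M. \<forall>m\<ge>M. \<forall>n\<ge>M. dist (alg_part (X m)) (alg_part (X n)) < e" by blast
  qed
  obtain l b where l: "(\<lambda>n. scalar_part (X n)) \<longlonglongrightarrow> l" and b: "(\<lambda>n. alg_part (X n)) \<longlonglongrightarrow> b"
    using s a by (meson Cauchy_convergent convergent_def)
  have "(\<lambda>n. norm (alg_part (X n) - b) + cmod (scalar_part (X n) - l)) \<longlonglongrightarrow> 0 + 0"
    using tendsto_add[OF tendsto_norm[OF LIM_zero[OF b]] tendsto_norm[OF LIM_zero[OF l]]] by simp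
  moreover have "norm (X n - Unit b l) \<le> norm (alg_part (X n) - b) + cmod (scalar_part (X n) - l)" for n
    by (simp add: minus_unitization_def norm_Unit_le)
  ultimately have "(\<lambda>n. X n - Unit b l) \<longlonglongrightarrow> 0"
    using Lim_null_comparison[OF always_eventually[OF allI]] by (metis (no_types, lifting) add_0)
  then have "X \<longlonglongrightarrow> Unit b l" by (rule LIM_zero_cancel)
  then show "convergent X" by (auto simp: convergent_def)
qed

instantiation unitization :: (cstar_algebra) unital_cstar_algebra
begin

definition "c *\<^sub>C x = Unit (c *\<^sub>C alg_part x) (c * scalar_part x)"
definition "star x = Unit (star (alg_part x)) (cnj (scalar_part x))"

lemma left_action_scaleC: "left_action (c *\<^sub>C x) b = c *\<^sub>C left_action x b"
  by (simp add: left_action_def scaleC_unitization_def scaleC_add_right scaleC_scaleC mult_scaleC_left)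

lemma norm_scaleC_unitization_le: "norm (c *\<^sub>C x) \<le> cmod c * norm (x::'a unitization)"
proof -
  have "onorm (left_action (c *\<^sub>C x)) \<le> cmod c * norm x"
    by (rule onorm_bound)
      (use norm_left_action_le[of x] in \<open>auto simp: left_action_scaleC norm_scaleC mult.assoc intro!: mult_left_mono\<close>)
  moreover have "cmod (scalar_part (c *\<^sub>C x)) \<le> cmod c * norm x"
    by (simp add: scaleC_unitization_def norm_mult mult_left_mono norm_scalar_part_le)
  ultimately show ?thesis by (simp add: norm_unitization_def[of "c *\<^sub>C x"])
qed

text \<open>
  The C*-identity is inherited from the algebra: \<open>\<parallel>x b\<parallel>\<^sup>2 = \<parallel>b\<^sup>* (x\<^sup>* x) b\<parallel>\<close> for \<open>b\<close> in the
  algebra. The reverse inequality follows from submultiplicativity once the star is isometric.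
\<close>

lemma norm_square_le_unitization: "(norm x)\<^sup>2 \<le> norm (star x * x :: 'a unitization)"
proof -
  let ?N = "norm (star x * x)"
  have adj: "star (left_action x b) * left_action x b = star b * left_action (star x * x) b" for b
    by (simp add: left_action_def star_unitization_def times_unitization_def star_simps
        scaleC_add_right algebra_simps mult_scaleC_left mult_scaleC_right scaleC_scaleC)
  have "norm (left_action x b) \<le> sqrt ?N * norm b" for b
  proof -
    have "(norm (left_action x b))\<^sup>2 = norm (star b * left_action (star x * x) b)"
      by (simp flip: adj add: cstar_identity)
    also have "\<dots> \<le> norm b * norm (left_action (star x * x) b)"
      using norm_mult_ineq[of "star b"] by simp
    also have "\<dots> \<le> norm b * (?N * norm b)"
      by (intro mult_left_mono norm_left_action_le) simp
    finally have "(norm (left_action x b))\<^sup>2 \<le> (sqrt ?N * norm b)\<^sup>2"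
      by (simp add: power2_eq_square algebra_simps)
    then show ?thesis by (rule power2_le_imp_le) simp
  qed
  then have 1: "onorm (left_action x) \<le> sqrt ?N"
    by (intro onorm_bound) auto
  have "(cmod (scalar_part x))\<^sup>2 = cmod (scalar_part (star x * x))"
    by (simp add: star_unitization_def norm_mult power2_eq_square)
  also have "\<dots> \<le> ?N" by (rule norm_scalar_part_le)
  finally have 2: "cmod (scalar_part x) \<le> sqrt ?N"
    by (simp add: real_le_rsqrt)
  from 1 2 have "norm x \<le> sqrt ?N" by (simp add: norm_unitization_def[of x])
  then show ?thesis
    using sqrt_ge_absD by fastforce
qed

instance
proof
  fix x y :: "'a unitization" and c d :: complex and r :: real
  show "r *\<^sub>R x = complex_of_real r *\<^sub>C x"
    by (simp add: scaleC_unitization_def scaleR_unitization_def scaleR_scaleC scaleR_conv_of_real)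
  show "c *\<^sub>C (x + y) = c *\<^sub>C x + c *\<^sub>C y" "(c + d) *\<^sub>C x = c *\<^sub>C x + d *\<^sub>C x"
    by (simp_all add: scaleC_unitization_def unitization_defs scaleC_add_right scaleC_add_left algebra_simps)
  show cc: "c *\<^sub>C (d *\<^sub>C x) = (c * d) *\<^sub>C x" for c d :: complex and x :: "'a unitization"
    by (simp_all add: scaleC_unitization_def scaleC_scaleC)
  show "c *\<^sub>C x * y = c *\<^sub>C (x * y)" "x * c *\<^sub>C y = c *\<^sub>C (x * y)"
    by (simp_all add: scaleC_unitization_def unitization_defs scaleC_add_right scaleC_scaleC
       mult_scaleC_left mult_scaleC_right algebra_simps)
  show "norm (c *\<^sub>C x) = cmod c * norm x"
  proof (cases "c = 0")
    case True
    then show ?thesis using norm_scaleC_unitization_le[of c x] by simp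
  next
    case False
    have one: "1 *\<^sub>C x = x" by (simp add: scaleC_unitization_def)
    have "norm x = norm (inverse c *\<^sub>C c *\<^sub>C x)"
      using False by (simp add: cc one)
    also have "\<dots> \<le> cmod (inverse c) * norm (c *\<^sub>C x)"
      by (rule norm_scaleC_unitization_le)
    finally have "cmod c * norm x \<le> norm (c *\<^sub>C x)"
      using False by (simp add: norm_inverse divide_simps mult_ac del: norm_divide add: norm_divide)
    then show ?thesis using norm_scaleC_unitization_le[of c x] by linarith
  qed
  show ss: "star (star x) = x" for x :: "'a unitization"
    by (simp add: star_unitization_def star_star)
  show "star (x + y) = star x + star y" "star (c *\<^sub>C x) = cnj c *\<^sub>C star x"
    by (simp_all add: star_unitization_def scaleC_unitization_def unitization_defs star_simps)
  show sm: "star (x * y) = star y * star x"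
    by (simp_all add: star_unitization_def unitization_defs star_simps)
  have le: "norm x \<le> norm (star x)" for x :: "'a unitization"
  proof (cases "x = 0")
    case False
    have "norm x * norm x \<le> norm (star x) * norm x"
      using order_trans[OF norm_square_le_unitization norm_mult_ineq[of "star x" x]]
      by (simp add: power2_eq_square)
    with False show ?thesis by simp
  qed simp
  have "norm (star x) = norm x"
    using le[of x] le[of "star x"] by (simp add: ss)
  then show "norm (star x * x) = (norm x)\<^sup>2"
    using norm_square_le_unitization[of x] norm_mult_ineq[of "star x" x]
    by (simp add: power2_eq_square)
qed

end

lemma unitize_simps:
  fixes a b :: "'a::cstar_algebra"
  shows "unitize (a + b) = unitize a + unitize b" "unitize (a - b) = unitize a - unitize b"
    "unitize (- a) = - unitize a" "unitize (a * b) = unitize a * unitize b" "unitize (c *\<^sub>C a) = c *\<^sub>C unitize a"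
    "unitize (r *\<^sub>R a) = r *\<^sub>R unitize a" "unitize (star a) = star (unitize a)" "unitize (0::'a) = 0"
  by (simp_all add: unitize_def unitization_defs scaleC_unitization_def star_unitization_def)

lemma scalar_part_star [simp]: "scalar_part (star x) = cnj (scalar_part x)"
  by (simp add: star_unitization_def)

lemma scalar_part_unitize [simp]: "scalar_part (unitize a) = 0"
  by (simp add: unitize_def)

lemma alg_part_unitize [simp]: "alg_part (unitize a) = a"
  by (simp add: unitize_def)

lemma unitize_alg_part: "scalar_part x = 0 \<Longrightarrow> unitize (alg_part x) = x"
  by (cases x) (simp add: unitize_def)

section \<open>Square roots and positive elements in unital C*-algebras\<close>

text \<open>
  The coefficients of the power series of \<open>sqrt (1 - x)\<close>. All but the first are nonpositive
  and their partial sums stay nonnegative, so the series converges absolutely on the closed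
  unit ball, and the absolute values of all coefficients but the first add up to at most \<open>1\<close>.
\<close>

definition sqrt_coeff :: "nat \<Rightarrow> real" where
  "sqrt_coeff n = ((1/2) gchoose n) * (-1) ^ n"

lemma sqrt_coeff_0 [simp]: "sqrt_coeff 0 = 1"
  by (simp add: sqrt_coeff_def)

lemma sqrt_coeff_pochhammer: "sqrt_coeff n = pochhammer (-1/2) n / fact n"
  by (simp add: sqrt_coeff_def gbinomial_pochhammer mult_ac flip: power_mult_distrib)

lemma sqrt_coeff_Suc_nonpos: "sqrt_coeff (Suc n) \<le> 0"
proof -
  have "pochhammer (-1/2 + 1) n \<ge> (0::real)"
    by (rule pochhammer_nonneg) simp
  then show ?thesis
    by (simp add: sqrt_coeff_pochhammer pochhammer_rec divide_nonpos_pos)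
qed

lemma sqrt_coeff_sum_nonneg: "(\<Sum>k\<le>n. sqrt_coeff k) \<ge> 0"
proof -
  have "(\<Sum>k\<le>n. sqrt_coeff k) = (- 1) ^ n * ((1/2) - 1 gchoose n)"
    unfolding sqrt_coeff_def by (rule gbinomial_sum_lower_neg)
  also have "\<dots> = pochhammer (1/2) n / fact n"
    by (simp add: gbinomial_pochhammer flip: power_mult_distrib)
  also have "\<dots> \<ge> 0"
    by (simp add: pochhammer_nonneg)
  finally show ?thesis .
qed

lemma sqrt_coeff_abs_sum_le: "(\<Sum>k<n. \<bar>sqrt_coeff (Suc k)\<bar>) \<le> 1"
proof -
  have "(\<Sum>k<n. \<bar>sqrt_coeff (Suc k)\<bar>) = - (\<Sum>k<n. sqrt_coeff (Suc k))"
    by (simp add: sqrt_coeff_Suc_nonpos sum_negf abs_of_nonpos)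
  also have "(\<Sum>k<n. sqrt_coeff (Suc k)) = (\<Sum>k\<le>n. sqrt_coeff k) - 1"
    by (simp add: lessThan_Suc_atMost[symmetric] sum.lessThan_Suc_shift del: sum.lessThan_Suc)
  finally show ?thesis using sqrt_coeff_sum_nonneg[of n] by simp
qed

lemma sqrt_coeff_summable: "summable (\<lambda>n. \<bar>sqrt_coeff (Suc n)\<bar>)"
  by (rule summableI_nonneg_bounded[of _ 1]) (simp_all add: sqrt_coeff_abs_sum_le)

lemma sqrt_coeff_suminf_le: "(\<Sum>n. \<bar>sqrt_coeff (Suc n)\<bar>) \<le> 1"
  by (rule suminf_le_const[OF sqrt_coeff_summable]) (rule sqrt_coeff_abs_sum_le)

text \<open>
  The Vandermonde identity says that the square of the formal series is \<open>1 - x\<close>.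
\<close>

lemma sqrt_coeff_convolution:
  "(\<Sum>i\<le>n. sqrt_coeff i * sqrt_coeff (n - i)) = (if n = 0 then 1 else if n = 1 then -1 else 0)"
proof -
  have "(\<Sum>i\<le>n. sqrt_coeff i * sqrt_coeff (n - i)) =
      (\<Sum>i\<le>n. (-1) ^ n * (((1/2) gchoose i) * ((1/2) gchoose (n - i))))"
    by (rule sum.cong) (auto simp: sqrt_coeff_def mult_ac simp flip: power_add)
  also have "\<dots> = (-1) ^ n * ((1/2 + 1/2) gchoose n)"
    by (simp only: sum_distrib_left[symmetric] gbinomial_Vandermonde[symmetric] atLeast0AtMost)
  also have "(1/2 + 1/2 :: real) gchoose n = real (1 choose n)"
    using binomial_gbinomial[of 1 n, where 'a=real] by simp
  also have "(-1) ^ n * real (1 choose n) = (if n = 0 then 1 else if n = 1 then -1 else 0)"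
    by (cases n) (auto simp: binomial_eq_0)
  finally show ?thesis .
qed

text \<open>
  The square root is a norm limit of polynomials in \<open>x\<close>. Hence it is self-adjoint and commutes
  with everything that commutes with \<open>x\<close>; the bound on \<open>1 - w\<close> allows the construction to be
  repeated for \<open>w\<close>.
\<close>

lemma sqrt_one_minus:
  fixes x :: "'a::unital_cstar_algebra"
  assumes sa: "star x = x" and le: "norm x \<le> 1"
  obtains w where "star w = w" "w * w = 1 - x" "norm (1 - w) \<le> 1"
    "\<And>z. z * x = x * z \<Longrightarrow> z * w = w * z"
proof -
  define f where "f n = sqrt_coeff n *\<^sub>R x ^ n" for n
  have nf: "norm (f n) \<le> \<bar>sqrt_coeff n\<bar>" for n
  proof -
    have "norm (x ^ n) \<le> 1"
      by (rule order_trans[OF norm_power_ineq]) (simp add: power_le_one le)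
    then show ?thesis by (simp add: f_def mult_left_le)
  qed
  have sn: "summable (\<lambda>n. norm (f n))"
  proof (subst summable_Suc_iff[symmetric], rule summable_comparison_test'[OF sqrt_coeff_summable])
    show "norm (norm (f (Suc n))) \<le> \<bar>sqrt_coeff (Suc n)\<bar>" for n using nf by simp
  qed
  have sf: "summable f" using sn by (rule summable_norm_cancel)
  define w where "w = suminf f"
  have "star w = (\<Sum>n. star (f n))"
    unfolding w_def by (rule bounded_linear.suminf[OF bounded_linear_star sf])
  moreover have "star (f n) = f n" for n
    by (simp add: f_def star_scaleR star_power sa)
  ultimately have 1: "star w = w"
    by (simp add: w_def)
  have conv: "(\<Sum>i\<le>k. f i * f (k - i)) = (if k = 0 then 1 else if k = 1 then -1 else 0) *\<^sub>R x ^ k" for k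
  proof -
    have "(\<Sum>i\<le>k. f i * f (k - i)) = (\<Sum>i\<le>k. (sqrt_coeff i * sqrt_coeff (k - i)) *\<^sub>R x ^ k)"
      by (rule sum.cong) (auto simp: f_def simp flip: power_add)
    then show ?thesis by (simp only: sqrt_coeff_convolution flip: scaleR_sum_left)
  qed
  have "(\<lambda>k. \<Sum>i\<le>k. f i * f (k - i)) sums (w * w)"
    unfolding w_def by (rule Cauchy_product_sums[OF sn sn])
  moreover have "(\<lambda>k. \<Sum>i\<le>k. f i * f (k - i)) sums (\<Sum>k\<in>{0, 1}. \<Sum>i\<le>k. f i * f (k - i))"
    by (rule sums_finite) (auto simp: conv)
  ultimately have 2: "w * w = 1 - x"
    using sums_unique2 by (fastforce simp: conv)
  have "w = (\<Sum>n. f (Suc n)) + f 0"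
    using suminf_split_head[OF sf] by (simp add: w_def)
  then have "norm (1 - w) = norm (\<Sum>n. f (Suc n))"
    by (simp add: f_def norm_minus_commute)
  also have "\<dots> \<le> (\<Sum>n. norm (f (Suc n)))"
    using sn summable_Suc_iff[of "\<lambda>n. norm (f n)"] by (intro summable_norm) simp
  also have "\<dots> \<le> (\<Sum>n. \<bar>sqrt_coeff (Suc n)\<bar>)"
    using sn summable_Suc_iff[of "\<lambda>n. norm (f n)"] nf sqrt_coeff_summable by (intro suminf_le) simp_all
  also have "\<dots> \<le> 1" by (rule sqrt_coeff_suminf_le)
  finally have 3: "norm (1 - w) \<le> 1" .
  have 4: "z * w = w * z" if z: "z * x = x * z" for z
  proof -
    have zp: "z * x ^ n = x ^ n * z" for n
      by (induction n) (simp_all add: mult.assoc z, metis mult.assoc z)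
    show ?thesis
      unfolding w_def suminf_mult[OF sf, of z, symmetric] suminf_mult2[OF sf, of z] by (simp add: f_def zp)
  qed
  show thesis using 1 2 3 4 that by blast
qed

text \<open>
  The lower bounds for norms of sums of nonnegative elements rest on this one: if \<open>t\<close> and \<open>g\<close>
  commute, then \<open>w = t + \<i> g\<close> is normal with \<open>w\<^sup>* w = t\<^sup>2 + g\<^sup>2\<close>, and \<open>t\<close> is the real part of
  \<open>w\<close>.
\<close>

lemma norm_le_commuting_squares:
  fixes t g :: "'a::unital_cstar_algebra"
  assumes t: "star t = t" and g: "star g = g" and c: "t * g = g * t"
  shows "(norm t)\<^sup>2 \<le> norm (t * t + g * g)"
proof -
  define w where "w = t + \<i> *\<^sub>C g"
  have sw: "star w = t - \<i> *\<^sub>C g"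
    by (simp add: w_def star_simps t g scaleC_minus_left)
  have "star w * w = t * t + g * g"
    by (simp add: sw, simp add: w_def algebra_simps mult_scaleC_left mult_scaleC_right c
        scaleC_add_right scaleC_diff_right)
  then have n: "norm (t * t + g * g) = (norm w)\<^sup>2"
    using cstar_identity[of w] by simp
  have "2 *\<^sub>R t = w + star w"
    by (simp add: sw, simp add: w_def scaleR_2)
  then have "2 * norm t = norm (w + star w)"
    by (metis abs_numeral norm_scaleR)
  also have "\<dots> \<le> 2 * norm w"
    using norm_triangle_ineq[of w "star w"] by simp
  finally show ?thesis by (simp add: n)
qed

text \<open>
  The square of a self-adjoint element is easier to handle than \<open>b\<^sup>* b\<close>: square roots by power
  series produce such squares, and no knowledge of the spectrum of \<open>b\<^sup>* b\<close> enters. That both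
  notions agree is Kaplansky's theorem below.
\<close>

definition nonneg :: "'a::unital_cstar_algebra \<Rightarrow> bool" where
  "nonneg x \<longleftrightarrow> (\<exists>w. star w = w \<and> x = w * w)"

lemma nonneg_selfadjoint: "nonneg x \<Longrightarrow> star x = x"
  by (auto simp: nonneg_def star_mult)

lemma nonneg_square: "star w = w \<Longrightarrow> nonneg (w * w)"
  by (auto simp: nonneg_def)

text \<open>
  After rescaling to \<open>\<rho> = 1\<close>, \<open>1 - t\<^sup>2\<close> is the square of some \<open>w\<close> commuting with \<open>t\<close>, and
  \<open>w\<^sup>2 + t\<^sup>2 = 1\<close> bounds the norm of \<open>w\<close>.
\<close>

lemma norm_scalar_minus_square_le:
  fixes t :: "'a::unital_cstar_algebra"
  assumes t: "star t = t" and le: "(norm t)\<^sup>2 \<le> \<rho>"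
  shows "norm (\<rho> *\<^sub>R 1 - t * t) \<le> \<rho>"
proof (cases "\<rho> = 0")
  case True
  then show ?thesis using le by simp
next
  case False
  with le have pos: "\<rho> > 0" by (smt (verit) zero_le_power2)
  let ?x = "(1/\<rho>) *\<^sub>R (t * t)"
  have "norm ?x \<le> 1"
    using pos le norm_square_selfadjoint[OF t] by (simp add: divide_simps)
  moreover have "star ?x = ?x" by (simp add: star_simps t)
  ultimately obtain w where w: "star w = w" "w * w = 1 - ?x" "\<And>z. z * ?x = ?x * z \<Longrightarrow> z * w = w * z"
    using sqrt_one_minus by metis
  let ?t = "(1 / sqrt \<rho>) *\<^sub>R t"
  have tt: "?t * ?t = ?x" using pos by (simp add: field_simps flip: power2_eq_square)
  have "w * ?t = ?t * w"
    using w(3)[of t] by (simp add: mult.assoc)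
  then have "(norm w)\<^sup>2 \<le> norm (w * w + ?t * ?t)"
    by (intro norm_le_commuting_squares) (simp_all add: w(1) star_simps t)
  also have "w * w + ?t * ?t = 1" unfolding w(2) tt by simp
  finally have "(norm w)\<^sup>2 \<le> 1" by simp
  then have "norm (1 - ?x) \<le> 1"
    using norm_square_selfadjoint[OF w(1)] by (simp add: w(2))
  then have "\<rho> * norm (1 - ?x) \<le> \<rho>" using pos by simp
  also have "\<rho> * norm (1 - ?x) = norm (\<rho> *\<^sub>R (1 - ?x))" using pos by simp
  also have "\<rho> *\<^sub>R (1 - ?x) = \<rho> *\<^sub>R 1 - t * t" using pos by (simp add: scaleR_diff_right)
  finally show ?thesis .
qed

lemma nonneg_norm_scalar_minus_le: "nonneg x \<Longrightarrow> norm x \<le> \<rho> \<Longrightarrow> norm (\<rho> *\<^sub>R 1 - x) \<le> \<rho>"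
  using norm_scalar_minus_square_le norm_square_selfadjoint by (fastforce simp: nonneg_def)

text \<open>
  The case \<open>\<rho> = 1\<close> is the binomial series for \<open>1 - x\<close>. The conclusion that \<open>w\<close> again lies
  within \<open>\<rho>\<close> of \<open>\<rho> 1\<close> makes \<open>w\<close> itself nonnegative.
\<close>

lemma commuting_sqrt:
  fixes x :: "'a::unital_cstar_algebra"
  assumes x: "star x = x" and le: "norm (\<rho>\<^sup>2 *\<^sub>R 1 - x) \<le> \<rho>\<^sup>2" and \<rho>: "\<rho> \<ge> 0"
  obtains w where "star w = w" "w * w = x" "norm (\<rho> *\<^sub>R 1 - w) \<le> \<rho>"
    "\<And>z. z * x = x * z \<Longrightarrow> z * w = w * z"
proof (cases "\<rho> = 0")
  case True
  with le have "x = 0" by simp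
  show thesis by (rule that[of 0]) (simp_all add: \<open>x = 0\<close> True)
next
  case False
  with \<rho> have pos: "\<rho> > 0" by simp
  let ?y = "1 - (1/\<rho>\<^sup>2) *\<^sub>R x"
  have "norm ((1/\<rho>\<^sup>2) *\<^sub>R (\<rho>\<^sup>2 *\<^sub>R 1 - x)) \<le> 1"
    using pos le by (simp add: divide_simps)
  then have "norm ?y \<le> 1" using pos by (simp add: scaleR_diff_right)
  moreover have "star ?y = ?y" by (simp add: star_simps x)
  ultimately obtain w where w: "star w = w" "w * w = 1 - ?y" "norm (1 - w) \<le> 1"
      "\<And>z. z * ?y = ?y * z \<Longrightarrow> z * w = w * z"
    using sqrt_one_minus by metis
  show thesis
  proof (rule that[of "\<rho> *\<^sub>R w"])
    show "star (\<rho> *\<^sub>R w) = \<rho> *\<^sub>R w" by (simp add: star_simps w)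
    show "\<rho> *\<^sub>R w * \<rho> *\<^sub>R w = x" using pos by (simp add: w(2) power2_eq_square)
    have "norm (\<rho> *\<^sub>R (1 - w)) \<le> \<rho>" using pos w(3) by simp
    then show "norm (\<rho> *\<^sub>R 1 - \<rho> *\<^sub>R w) \<le> \<rho>" by (simp add: scaleR_diff_right)
    show "z * \<rho> *\<^sub>R w = \<rho> *\<^sub>R w * z" if "z * x = x * z" for z
      using w(4)[of z] that by (simp add: algebra_simps)
  qed
qed

text \<open>
  Nonnegativity is a condition on the distance to a large scalar. In this form it is visibly
  stable under sums.
\<close>

lemma nonneg_iff_norm:
  "nonneg x \<longleftrightarrow> star x = x \<and> (\<exists>\<rho>\<ge>0. norm (\<rho> *\<^sub>R 1 - x) \<le> \<rho>)"
proof
  assume "nonneg x"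
  then show "star x = x \<and> (\<exists>\<rho>\<ge>0. norm (\<rho> *\<^sub>R 1 - x) \<le> \<rho>)"
    using nonneg_selfadjoint nonneg_norm_scalar_minus_le[of x "norm x"] norm_ge_zero[of x] by blast
next
  assume "star x = x \<and> (\<exists>\<rho>\<ge>0. norm (\<rho> *\<^sub>R 1 - x) \<le> \<rho>)"
  then obtain \<rho> where \<rho>: "star x = x" "\<rho> \<ge> 0" "norm (\<rho> *\<^sub>R 1 - x) \<le> \<rho>" by blast
  then have "norm ((sqrt \<rho>)\<^sup>2 *\<^sub>R 1 - x) \<le> (sqrt \<rho>)\<^sup>2" "sqrt \<rho> \<ge> 0" by simp_all
  with \<rho>(1) obtain w where "star w = w" "w * w = x"
    using commuting_sqrt by metis
  then show "nonneg x" by (auto simp: nonneg_def)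
qed

lemma nonnegI_norm: "star x = x \<Longrightarrow> norm (\<rho> *\<^sub>R 1 - x) \<le> \<rho> \<Longrightarrow> nonneg x"
  using nonneg_iff_norm[of x] norm_ge_zero order_trans by blast

lemma nonneg_commuting_sqrt:
  assumes "nonneg x"
  obtains w where "star w = w" "w * w = x" "\<And>z. z * x = x * z \<Longrightarrow> z * w = w * z"
proof -
  have "norm ((sqrt (norm x))\<^sup>2 *\<^sub>R 1 - x) \<le> (sqrt (norm x))\<^sup>2" "sqrt (norm x) \<ge> 0"
    using nonneg_norm_scalar_minus_le[OF assms order_refl] by simp_all
  then show thesis
    using commuting_sqrt[OF nonneg_selfadjoint[OF assms]] that by metis
qed

lemma nonneg_zero [simp]: "nonneg 0"
  using nonneg_square[of 0] by simp

lemma nonneg_one [simp]: "nonneg 1"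
  using nonneg_square[of 1] by simp

lemma nonneg_scaleR: "nonneg x \<Longrightarrow> r \<ge> 0 \<Longrightarrow> nonneg (r *\<^sub>R x)"
  unfolding nonneg_def
  by (metis (no_types, lifting) mult_scaleR_left mult_scaleR_right real_sqrt_mult_self scaleR_scaleR star_scaleR abs_of_nonneg)

lemma nonneg_add:
  assumes x: "nonneg x" and y: "nonneg y"
  shows "nonneg (x + y)"
proof (rule nonnegI_norm)
  show "star (x + y) = x + y"
    using assms by (simp add: star_add nonneg_selfadjoint)
  have eq: "(norm x + norm y) *\<^sub>R 1 - (x + y) = (norm x *\<^sub>R 1 - x) + (norm y *\<^sub>R 1 - y)"
    by (simp add: algebra_simps)
  show "norm ((norm x + norm y) *\<^sub>R 1 - (x + y)) \<le> norm x + norm y"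
    unfolding eq by (intro norm_triangle_mono nonneg_norm_scalar_minus_le x y order_refl)
qed

lemma nonneg_sum: "(\<And>i. i \<in> I \<Longrightarrow> nonneg (f i)) \<Longrightarrow> nonneg (sum f I)"
  by (induction I rule: infinite_finite_induct) (simp_all add: nonneg_add)

lemma nonneg_mult_commuting:
  assumes x: "nonneg x" and y: "nonneg y" and c: "x * y = y * x"
  shows "nonneg (x * y)"
proof -
  obtain s where s: "star s = s" "s * s = x" "\<And>z. z * x = x * z \<Longrightarrow> z * s = s * z"
    using nonneg_commuting_sqrt[OF x] by metis
  obtain t where t: "star t = t" "t * t = y" "\<And>z. z * y = y * z \<Longrightarrow> z * t = t * z"
    using nonneg_commuting_sqrt[OF y] by metis
  have "y * s = s * y" using s(3)[of y] c by simp
  then have st: "s * t = t * s" using t(3)[of s] by simp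
  have "(s * t) * (s * t) = x * y"
    by (metis mult.assoc s(2) st t(2))
  moreover have "star (s * t) = s * t" by (simp add: star_mult s t st)
  ultimately show ?thesis by (metis nonneg_square)
qed

text \<open>
  The element \<open>\<rho> - r - t\<^sup>2\<close>, with \<open>\<rho>\<close> the norm of \<open>r + t\<^sup>2\<close>, has a square root \<open>g\<close> commuting
  with \<open>t\<close>. So \<open>t\<^sup>2 + g\<^sup>2\<close> is the scalar \<open>\<rho> - r\<close> and bounds \<open>\<parallel>t\<parallel>\<^sup>2\<close>.
\<close>

lemma norm_scalar_plus_nonneg:
  assumes x: "nonneg x" and r: "r \<ge> 0"
  shows "norm (r *\<^sub>R 1 + x) = r + norm x"
proof (rule antisym)
  show "norm (r *\<^sub>R 1 + x) \<le> r + norm x"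
    using norm_triangle_ineq[of "r *\<^sub>R 1" x] r by simp
  obtain t where t: "star t = t" "x = t * t"
    using x by (auto simp: nonneg_def)
  define \<rho> where "\<rho> = norm (r *\<^sub>R 1 + x)"
  have "(norm (sqrt r *\<^sub>R (1::'a)))\<^sup>2 \<le> norm ((sqrt r *\<^sub>R 1) * (sqrt r *\<^sub>R 1) + t * t)"
    by (rule norm_le_commuting_squares) (simp_all add: star_simps t)
  \<comment> \<open>The commuting squares here are \<open>r 1\<close> and \<open>t\<^sup>2\<close>; without \<open>r \<le> \<rho>\<close> the scalar \<open>\<rho> - r\<close>
      below could be negative.\<close>
  then have "r \<le> \<rho>" using r by (simp add: \<rho>_def t)
  let ?y = "\<rho> *\<^sub>R 1 - (r *\<^sub>R 1 + x)"
  have "norm (\<rho> *\<^sub>R 1 - ?y) \<le> \<rho>" by (simp add: \<rho>_def add.commute)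
  then have "nonneg ?y"
    by (rule nonnegI_norm[rotated]) (use nonneg_selfadjoint[OF x] in \<open>simp add: star_simps\<close>)
  then obtain g where g: "star g = g" "g * g = ?y" "\<And>z. z * ?y = ?y * z \<Longrightarrow> z * g = g * z"
    using nonneg_commuting_sqrt by metis
  have "t * g = g * t"
    by (rule g(3)) (simp add: t algebra_simps)
  then have "(norm t)\<^sup>2 \<le> norm (t * t + g * g)"
    by (intro norm_le_commuting_squares t(1) g(1))
  also have "t * t + g * g = (\<rho> - r) *\<^sub>R 1"
    by (simp add: g t algebra_simps)
  finally show "r + norm x \<le> norm (r *\<^sub>R 1 + x)"
    using \<open>r \<le> \<rho>\<close> t(2) norm_square_selfadjoint[OF t(1)] \<rho>_def by simp
qed

lemma nonneg_scalar_minus: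
  assumes "star x = x" "norm x \<le> r"
  shows "nonneg (r *\<^sub>R 1 - x)"
  using nonnegI_norm[of "r *\<^sub>R 1 - x" r] assms by (simp add: star_simps)

text \<open>
  Since \<open>x \<le> y \<le> \<parallel>y\<parallel> 1\<close>, the element \<open>\<parallel>y\<parallel> 1 - x\<close> is nonnegative. Comparing it with a large
  scalar turns this into a bound on the norm of a scalar plus \<open>x\<close>, which is the sum of the
  norms.
\<close>

lemma nonneg_norm_mono:
  assumes x: "nonneg x" and yx: "nonneg (y - x)"
  shows "norm x \<le> norm y"
proof -
  have sx: "star x = x" using nonneg_selfadjoint[OF x] .
  have "star (y - x) = y - x" by (rule nonneg_selfadjoint[OF yx])
  then have sy: "star y = y" using sx by (simp add: star_diff)
  let ?d = "norm y *\<^sub>R 1 - x"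
  have "nonneg ((norm y *\<^sub>R 1 - y) + (y - x))"
    by (intro nonneg_add yx nonneg_scalar_minus sy order_refl)
  then have d: "nonneg ?d" by simp
  define \<rho> where "\<rho> = norm y + norm ?d"
  have "norm ?d \<le> \<rho>" by (simp add: \<rho>_def)
  then have "norm (\<rho> *\<^sub>R 1 - ?d) \<le> \<rho>"
    by (rule nonneg_norm_scalar_minus_le[OF d])
  also have "\<rho> *\<^sub>R 1 - ?d = norm ?d *\<^sub>R 1 + x" by (simp add: \<rho>_def algebra_simps)
  finally show ?thesis using norm_scalar_plus_nonneg[OF x, of "norm ?d"] by (simp add: \<rho>_def)
qed

text \<open>
  The product of \<open>r - x\<close> and \<open>r + x\<close> is \<open>r\<^sup>2 - x\<^sup>2\<close>, so \<open>x\<^sup>2\<close> lies below the scalar \<open>r\<^sup>2\<close>.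
\<close>

lemma selfadjoint_norm_le_if_nonneg:
  assumes sx: "star x = x" and a: "nonneg (r *\<^sub>R 1 - x)" and b: "nonneg (r *\<^sub>R 1 + x)"
  shows "norm x \<le> \<bar>r\<bar>"
proof -
  have "nonneg ((r *\<^sub>R 1 - x) * (r *\<^sub>R 1 + x))"
    by (intro nonneg_mult_commuting a b) (simp add: algebra_simps)
  also have "(r *\<^sub>R 1 - x) * (r *\<^sub>R 1 + x) = r\<^sup>2 *\<^sub>R 1 - x * x"
    by (simp add: algebra_simps power2_eq_square)
  finally have "norm (x * x) \<le> norm (r\<^sup>2 *\<^sub>R (1::'a))"
    by (intro nonneg_norm_mono nonneg_square sx)
  then have "(norm x)\<^sup>2 \<le> \<bar>r\<bar>\<^sup>2" by (simp add: norm_square_selfadjoint[OF sx])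
  then show ?thesis by (rule power2_le_imp_le) simp
qed

text \<open>
  The real and imaginary parts of \<open>b\<close> express \<open>b\<^sup>* b + b b\<^sup>*\<close> as a sum of squares, so \<open>b b\<^sup>*\<close> is
  nonnegative while \<open>b\<^sup>* b\<close> is nonpositive. Instead of comparing the spectra of these two
  elements, one squares \<open>r + b b\<^sup>*\<close> with \<open>r = \<parallel>b\<parallel>\<^sup>2\<close>: the square is \<open>r\<^sup>2 + b (2 r + b\<^sup>* b) b\<^sup>*\<close>,
  whose norm is at most \<open>3 r\<^sup>2\<close> because \<open>r + b\<^sup>* b\<close> has norm at most \<open>r\<close>, whereas nonnegativity
  of \<open>b b\<^sup>*\<close> makes it \<open>4 r\<^sup>2\<close>.
\<close>

lemma star_mult_self_eq_minus_square_imp_zero: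
  fixes b m :: "'a::unital_cstar_algebra"
  assumes m: "star m = m" and bm: "star b * b = - (m * m)"
  shows "b = 0"
proof (rule ccontr)
  assume "b \<noteq> 0"
  define r where "r = (norm b)\<^sup>2"
  have r: "r > 0" using \<open>b \<noteq> 0\<close> by (simp add: r_def)
  obtain c d where c: "star c = c" and d: "star d = d" and b: "b = c + \<i> *\<^sub>C d"
    by (rule cartesian_decomposition)
  have sb: "star b = c - \<i> *\<^sub>C d"
    by (simp add: b star_simps c d scaleC_minus_left)
  have "star b * b + b * star b = 2 *\<^sub>R (c * c) + 2 *\<^sub>R (d * d)"
    by (simp only: sb) (simp add: b algebra_simps mult_scaleC_left mult_scaleC_right scaleR_2
        scaleC_add_right scaleC_diff_right)
  then have bb: "b * star b = 2 *\<^sub>R (c * c) + 2 *\<^sub>R (d * d) + m * m"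
    by (simp add: bm algebra_simps)
  have "nonneg (b * star b)"
    unfolding bb by (intro nonneg_add nonneg_scaleR nonneg_square c d m) simp_all
  let ?Y = "r *\<^sub>R 1 + b * star b"
  have "norm ?Y = 2 * r"
    using norm_scalar_plus_nonneg[OF \<open>nonneg (b * star b)\<close>, of r] r
    by (simp add: r_def cstar_identity')
  moreover have "star ?Y = ?Y" by (simp add: star_simps)
  ultimately have Y: "norm (?Y * ?Y) = 4 * r\<^sup>2"
    by (simp add: norm_square_selfadjoint power_mult_distrib)
  have nm: "(norm m)\<^sup>2 = r"
    using norm_square_selfadjoint[OF m] cstar_identity[of b] by (simp add: bm r_def)
  have "norm (r *\<^sub>R 1 + star b * b) \<le> r"
    using norm_scalar_minus_square_le[OF m, of r] nm by (simp add: bm)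
  moreover have "norm (r *\<^sub>R 1 + (r *\<^sub>R 1 + star b * b)) \<le> r + norm (r *\<^sub>R 1 + star b * b)"
    using norm_triangle_ineq[of "r *\<^sub>R (1::'a)"] r by simp
  ultimately have S: "norm (r *\<^sub>R 1 + (r *\<^sub>R 1 + star b * b)) \<le> 2 * r" by simp
  have "?Y * ?Y = r\<^sup>2 *\<^sub>R 1 + b * (r *\<^sub>R 1 + (r *\<^sub>R 1 + star b * b)) * star b"
    by (simp add: algebra_simps power2_eq_square)
  also have "norm \<dots> \<le> r\<^sup>2 + norm (b * (r *\<^sub>R 1 + (r *\<^sub>R 1 + star b * b)) * star b)"
    using norm_triangle_ineq[of "r\<^sup>2 *\<^sub>R (1::'a)"] by simp
  also have "norm (b * (r *\<^sub>R 1 + (r *\<^sub>R 1 + star b * b)) * star b) \<le> norm b * (2 * r) * norm (star b)"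
    by (intro norm_mult_ineq[THEN order_trans] mult_right_mono mult_left_mono S)
       (simp_all add: S)
  also have "\<dots> = 2 * r\<^sup>2" by (simp add: r_def power2_eq_square)
  finally have "4 * r\<^sup>2 \<le> 3 * r\<^sup>2" by (simp add: Y)
  then show False using r by simp
qed

text \<open>
  Let \<open>k\<close> be the absolute value of \<open>x = a\<^sup>* a\<close>, the nonnegative square root of \<open>x\<^sup>2\<close>, and
  \<open>n = k - x\<close>, which is twice the negative part of \<open>x\<close>. Then \<open>x n = -k n\<close>, so \<open>b = a n\<close>
  satisfies \<open>b\<^sup>* b = n x n = -n k n\<close>, which is minus a square. By the preceding lemma \<open>b = 0\<close>,
  which forces \<open>n = 0\<close> and \<open>x = k\<close>.
\<close>

theorem nonneg_star_mult_self:
  fixes a :: "'a::unital_cstar_algebra"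
  shows "nonneg (star a * a)"
proof -
  define x where "x = star a * a"
  have sx: "star x = x" by (simp add: x_def star_simps)
  have "norm ((norm x)\<^sup>2 *\<^sub>R 1 - x * x) \<le> (norm x)\<^sup>2"
    by (rule norm_scalar_minus_square_le[OF sx order_refl])
  moreover have "star (x * x) = x * x" by (simp add: star_mult sx)
  ultimately obtain k where k: "star k = k" "k * k = x * x" "norm (norm x *\<^sub>R 1 - k) \<le> norm x"
      "\<And>z. z * (x * x) = (x * x) * z \<Longrightarrow> z * k = k * z"
    using commuting_sqrt[of "x * x" "norm x", OF _ _ norm_ge_zero] by metis
  have xk: "x * k = k * x" by (rule k(4)) (simp add: mult.assoc)
  have "nonneg k" using k(1,3) by (rule nonnegI_norm)
  then obtain s where s: "star s = s" "s * s = k" "\<And>z. z * k = k * z \<Longrightarrow> z * s = s * z"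
    using nonneg_commuting_sqrt by metis
  define n where "n = k - x"
  have sn: "star n = n" by (simp add: n_def star_simps k sx)
  have ns: "n * s = s * n" by (rule s(3)) (simp add: n_def algebra_simps xk)
  have xn: "x * n = - (k * n)" by (simp add: n_def algebra_simps xk k(2))
  have "star (a * n) * (a * n) = n * (x * n)"
    by (simp add: star_mult sn x_def mult.assoc)
  also have "\<dots> = - ((n * s) * (s * n))"
    by (simp add: xn mult.assoc flip: s(2))
  also have "\<dots> = - ((s * n) * (s * n))"
    by (simp only: ns)
  finally have eq: "star (a * n) * (a * n) = - ((s * n) * (s * n))" .
  have ssn: "star (s * n) = s * n" by (simp add: star_mult s sn ns)
  have "a * n = 0"
    by (rule star_mult_self_eq_minus_square_imp_zero[OF ssn eq])
  with eq have "(s * n) * (s * n) = 0" by simp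
  then have "s * n = 0" using norm_square_selfadjoint[OF ssn] by simp
  then have "k * n = 0" by (simp add: mult.assoc flip: s(2))
  with xn have "n * n = 0" using left_diff_distrib[of k x n] by (simp flip: n_def)
  then have "n = 0" using norm_square_selfadjoint[OF sn] by simp
  then have "x = k" by (simp add: n_def)
  with \<open>nonneg k\<close> show ?thesis by (simp add: x_def)
qed

section \<open>Approximate units\<close>

lemma one_minus_mult_geometric_sum:
  fixes x :: "'a::ring_1"
  shows "(\<Sum>k<n. x * (1 - x) ^ k) = 1 - (1 - x) ^ n"
  by (induction n) (simp_all add: algebra_simps)

lemma nonneg_power: "nonneg y \<Longrightarrow> nonneg (y ^ n)"
  by (induction n) (simp_all add: nonneg_mult_commuting power_commutes)

context
  fixes x :: "'a::unital_cstar_algebra"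
  assumes x: "nonneg x" and le: "norm x \<le> 1"
begin

lemma nonneg_one_minus_power: "nonneg ((1 - x) ^ n)"
  using nonneg_power[OF nonneg_scalar_minus[OF nonneg_selfadjoint[OF x] le]] by simp

lemma norm_one_minus_power_le: "norm ((1 - x) ^ n) \<le> 1"
proof -
  have "norm (1 - x) \<le> 1" using nonneg_norm_scalar_minus_le[OF x le] by simp
  then show ?thesis by (meson norm_ge_zero norm_power_ineq order_trans power_le_one)
qed

lemma nonneg_approximate_unit: "nonneg (1 - (1 - x) ^ n)"
  using nonneg_scalar_minus[OF nonneg_selfadjoint[OF nonneg_one_minus_power] norm_one_minus_power_le]
  by simp

lemma norm_approximate_unit_le: "norm (1 - (1 - x) ^ n) \<le> 1"
  using nonneg_norm_scalar_minus_le[OF nonneg_one_minus_power norm_one_minus_power_le] by simp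

lemma one_minus_power_diff:
  assumes "n \<le> m"
  shows "nonneg ((1 - x) ^ n - (1 - x) ^ m)" "norm ((1 - x) ^ n - (1 - x) ^ m) \<le> 1"
proof -
  have eq: "(1 - x) ^ n - (1 - x) ^ m = (1 - x) ^ n * (1 - (1 - x) ^ (m - n))"
    using assms by (simp add: right_diff_distrib flip: power_add)
  show "nonneg ((1 - x) ^ n - (1 - x) ^ m)"
    unfolding eq
    by (intro nonneg_mult_commuting nonneg_one_minus_power nonneg_approximate_unit)
       (simp add: algebra_simps flip: power_add)
  have "norm ((1 - x) ^ n - (1 - x) ^ m) \<le> norm ((1 - x) ^ n) * norm (1 - (1 - x) ^ (m - n))"
    unfolding eq by (rule norm_mult_ineq)
  also have "\<dots> \<le> 1 * 1"
    by (intro mult_mono norm_one_minus_power_le norm_approximate_unit_le) simp_all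
  finally show "norm ((1 - x) ^ n - (1 - x) ^ m) \<le> 1" by simp
qed

text \<open>
  Put \<open>v\<^sub>k = (1 - x)\<^sup>k\<close>. As \<open>v\<^sub>k\<close> decreases in \<open>k\<close>, the element \<open>(n + 1) x v\<^sub>n\<close> lies below
  \<open>x v\<^sub>0 + \<dots> + x v\<^sub>n = 1 - v\<close> with \<open>v = (1 - x)\<^sup>n\<^sup>+\<^sup>1\<close>, which has norm at most \<open>1\<close>. This replaces
  the estimate of \<open>t (1 - t)\<^sup>n\<close> on \<open>[0, 1]\<close> by functional calculus.
\<close>

lemma norm_mult_one_minus_power_le: "norm (x * (1 - x) ^ n) \<le> 1 / real (Suc n)"
proof -
  let ?y = "1 - x"
  have c: "x * ?y ^ n = ?y ^ n * x" for n
    by (rule power_commuting_commutes[symmetric]) (simp add: algebra_simps)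
  have nn: "nonneg (x * ?y ^ n)"
    by (intro nonneg_mult_commuting x nonneg_one_minus_power c)
  have "nonneg (\<Sum>k<Suc n. x * (?y ^ k - ?y ^ n))"
  proof (intro nonneg_sum nonneg_mult_commuting x one_minus_power_diff)
    fix k assume "k \<in> {..<Suc n}"
    then show "k \<le> n" by simp
    show "x * (?y ^ k - ?y ^ n) = (?y ^ k - ?y ^ n) * x"
      by (simp only: right_diff_distrib left_diff_distrib c)
  qed
  also have "(\<Sum>k<Suc n. x * (?y ^ k - ?y ^ n)) = (1 - ?y ^ Suc n) - real (Suc n) *\<^sub>R (x * ?y ^ n)"
    by (simp add: right_diff_distrib sum_subtractf one_minus_mult_geometric_sum sum_constant_scaleR
        scaleR_conv_of_real del: sum.lessThan_Suc power_Suc)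
  finally have "norm (real (Suc n) *\<^sub>R (x * ?y ^ n)) \<le> norm (1 - ?y ^ Suc n)"
    by (intro nonneg_norm_mono nonneg_scaleR nn) simp_all
  also have "\<dots> \<le> 1" by (rule norm_approximate_unit_le)
  finally show ?thesis by (simp add: pos_le_divide_eq mult.commute del: of_nat_Suc)
qed

end

lemma norm_one_minus_power_mult_le:
  fixes a :: "'a::unital_cstar_algebra"
  assumes "norm a \<le> 1"
  shows "(norm ((1 - a * star a) ^ n * a))\<^sup>2 \<le> 1 / real (Suc n)"
proof -
  define x where "x = a * star a"
  have x: "nonneg x" using nonneg_star_mult_self[of "star a"] by (simp add: x_def star_star)
  have nx: "norm x \<le> 1" using assms by (simp add: x_def cstar_identity' power_le_one)
  let ?v = "(1 - x) ^ n"
  have sv: "star ?v = ?v" by (rule nonneg_selfadjoint[OF nonneg_one_minus_power[OF x nx]])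
  have "(norm (?v * a))\<^sup>2 = norm (?v * (x * ?v))"
    by (simp add: cstar_identity'[symmetric] star_mult sv mult.assoc) (simp add: x_def mult.assoc)
  also have "\<dots> \<le> norm ?v * norm (x * ?v)" by (rule norm_mult_ineq)
  also have "\<dots> \<le> 1 * (1 / real (Suc n))"
    by (intro mult_mono norm_one_minus_power_le norm_mult_one_minus_power_le x nx) simp_all
  finally show ?thesis by (simp add: x_def)
qed

lemma scalar_part_power [simp]: "scalar_part (x ^ n) = scalar_part x ^ n"
  by (induction n) simp_all

text \<open>
  With \<open>x = b b\<^sup>*\<close> for a rescaling \<open>b\<close> of \<open>a\<close> into the unit ball, the elements \<open>1 - (1 - x)\<^sup>n\<close>
  have no scalar part, so they belong to the algebra itself.
\<close>

lemma approximate_left_unit: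
  fixes a :: "'a::cstar_algebra"
  obtains e :: "nat \<Rightarrow> 'a" where "\<And>n. norm (e n) \<le> 1" "(\<lambda>n. e n * a) \<longlonglongrightarrow> a"
proof -
  define c where "c = 1 / (1 + norm a)"
  have c: "c > 0" by (simp add: c_def add_pos_nonneg)
  define b where "b = unitize (c *\<^sub>R a)"
  have b: "norm b \<le> 1" by (simp add: b_def c_def add_nonneg_nonneg divide_simps) (smt (verit) norm_ge_zero)
  define u where "u n = 1 - (1 - b * star b) ^ n" for n
  define e where "e n = alg_part (u n)" for n
  have eu: "unitize (e n) = u n" for n
    unfolding e_def by (rule unitize_alg_part) (simp add: u_def b_def)
  have "nonneg (b * star b)" using nonneg_star_mult_self[of "star b"] by (simp add: star_star)
  moreover have "norm (b * star b) \<le> 1" using b by (simp add: cstar_identity' power_le_one)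
  ultimately have un: "norm (u n) \<le> 1" for n unfolding u_def by (rule norm_approximate_unit_le)
  have "norm (e n) \<le> 1" for n using un[of n] eu[of n] norm_unitize[of "e n"] by simp
  moreover have "(\<lambda>n. e n * a) \<longlonglongrightarrow> a"
  proof -
    have "norm (e n * a - a) \<le> (1 / c) * sqrt (1 / real (Suc n))" for n
    proof -
      have "c * norm (e n * a - a) = norm (unitize (c *\<^sub>R (e n * a - a)))" using c by simp
      also have "unitize (c *\<^sub>R (e n * a - a)) = u n * b - b"
        by (simp add: unitize_simps b_def scaleR_diff_right flip: eu)
      also have "u n * b - b = - ((1 - b * star b) ^ n * b)"
        by (simp add: u_def algebra_simps)
      finally have "c * norm (e n * a - a) = norm ((1 - b * star b) ^ n * b)" by simp
      also have "\<dots> \<le> sqrt (1 / real (Suc n))"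
        using norm_one_minus_power_mult_le[OF b, of n] by (rule real_le_rsqrt)
      finally show ?thesis using c by (simp add: field_simps)
    qed
    moreover have "(\<lambda>n. (1 / c) * sqrt (1 / real (Suc n))) \<longlonglongrightarrow> (1 / c) * sqrt 0"
      using LIMSEQ_inverse_real_of_nat by (intro tendsto_intros) (simp add: inverse_eq_divide)
    ultimately have "(\<lambda>n. e n * a - a) \<longlonglongrightarrow> 0"
      using Lim_null_comparison[OF always_eventually[OF allI]] by (metis (no_types, lifting) real_sqrt_zero mult_zero_right)
    then show ?thesis by (rule LIM_zero_cancel)
  qed
  ultimately show thesis using that by blast
qed

section \<open>Positive functionals\<close>

definition positive_functional :: "('a::cstar_algebra \<Rightarrow> complex) \<Rightarrow> bool" where
  "positive_functional \<phi> \<longleftrightarrow> (\<forall>x y. \<phi> (x + y) = \<phi> x + \<phi> y) \<and> (\<forall>c x. \<phi> (c *\<^sub>C x) = c * \<phi> x) \<and>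
     (\<forall>x. 0 \<le> \<phi> (star x * x))"

context
  fixes \<phi> :: "'a::cstar_algebra \<Rightarrow> complex"
  assumes \<phi>: "positive_functional \<phi>"
begin

lemma positive_functional_add: "\<phi> (x + y) = \<phi> x + \<phi> y"
  and positive_functional_scaleC: "\<phi> (c *\<^sub>C x) = c * \<phi> x"
  and positive_functional_Re: "0 \<le> Re (\<phi> (star x * x))"
  and positive_functional_Im: "Im (\<phi> (star x * x)) = 0"
  using \<phi> by (simp_all add: positive_functional_def less_eq_complex_def)

lemma positive_functional_zero: "\<phi> 0 = 0"
  using positive_functional_scaleC[of 0 0] by simp

lemma positive_functional_minus: "\<phi> (- x) = - \<phi> x"
  using positive_functional_scaleC[of "-1" x] by (simp add: scaleC_minus_left)

lemma positive_functional_diff: "\<phi> (x - y) = \<phi> x - \<phi> y"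
  using positive_functional_add[of x "- y"] by (simp add: positive_functional_minus)

lemma positive_functional_scaleR: "\<phi> (r *\<^sub>R x) = r *\<^sub>R \<phi> x"
  by (simp add: scaleR_scaleC positive_functional_scaleC scaleR_conv_of_real)

lemmas positive_functional_linear = positive_functional_add positive_functional_scaleC
  positive_functional_minus positive_functional_diff positive_functional_scaleR positive_functional_zero

lemma positive_functional_expand:
  "\<phi> (star (x + c *\<^sub>C y) * (x + c *\<^sub>C y)) = \<phi> (star x * x) + c * \<phi> (star x * y)
      + cnj c * \<phi> (star y * x) + cnj c * c * \<phi> (star y * y)"
  by (simp add: star_simps algebra_simps mult_scaleC_left mult_scaleC_right scaleC_scaleC
      positive_functional_linear)

text \<open>
  The expansion of \<open>\<phi>\<close> at \<open>(x + c y)\<^sup>* (x + c y)\<close> is real for \<open>c = 1\<close> and for \<open>c = \<i>\<close>.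
\<close>

lemma positive_functional_hermitian: "\<phi> (star x * y) = cnj (\<phi> (star y * x))"
proof (rule complex_eqI)
  have "Im (\<phi> (star x * x) + 1 * \<phi> (star x * y) + cnj 1 * \<phi> (star y * x) + cnj 1 * 1 * \<phi> (star y * y)) = 0"
    unfolding positive_functional_expand[symmetric] by (rule positive_functional_Im)
  then show "Im (\<phi> (star x * y)) = Im (cnj (\<phi> (star y * x)))"
    by (simp add: positive_functional_Im)
  have "Im (\<phi> (star x * x) + \<i> * \<phi> (star x * y) + cnj \<i> * \<phi> (star y * x) + cnj \<i> * \<i> * \<phi> (star y * y)) = 0"
    unfolding positive_functional_expand[symmetric] by (rule positive_functional_Im)
  then show "Re (\<phi> (star x * y)) = Re (cnj (\<phi> (star y * x)))"
    by (simp add: positive_functional_Im)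
qed

lemma positive_functional_Cauchy_Schwarz:
  "(cmod (\<phi> (star y * x)))\<^sup>2 \<le> Re (\<phi> (star y * y)) * Re (\<phi> (star x * x))"
proof -
  define z P R where "z = \<phi> (star y * x)" and "P = Re (\<phi> (star x * x))" and "R = Re (\<phi> (star y * y))"
  define w where "w = (cmod z)\<^sup>2"
  have zz: "z * cnj z = of_real w" by (simp only: w_def complex_norm_square)
  \<comment> \<open>Positivity at \<open>x - t z y\<close>; the factor \<open>z\<close> rotates the mixed terms onto the real
      axis.\<close>
  have quad: "0 \<le> P - 2 * t * w + t\<^sup>2 * w * R" for t :: real
  proof -
    define c where "c = - of_real t * z"
    have "0 \<le> Re (\<phi> (star (x + c *\<^sub>C y) * (x + c *\<^sub>C y)))" by (rule positive_functional_Re)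
    also have "\<dots> = P + Re (c * cnj z) + Re (cnj c * z) + Re (cnj c * c * \<phi> (star y * y))"
      by (simp only: positive_functional_expand positive_functional_hermitian[of x y] plus_complex.sel
          z_def[symmetric] P_def)
    also have "c * cnj z = of_real (- t * w)" by (simp add: c_def zz mult.assoc)
    also have "cnj c * z = of_real (- t * w)" using zz by (simp add: c_def mult.assoc mult.commute)
    also have "cnj c * c = of_real (t\<^sup>2 * w)" using zz by (simp add: c_def power2_eq_square mult_ac)
    finally show ?thesis by (simp add: R_def)
  qed
  have R: "R \<ge> 0" by (simp add: R_def positive_functional_Re)
  have "w \<le> R * P"
  proof (cases "R = 0")
    case True
    have "w = 0"
    proof (rule ccontr)
      assume "w \<noteq> 0"
      then show False using quad[of "(P + 1) / (2 * w)"] by (simp add: True)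
    qed
    then show ?thesis using True by simp
  next
    case False
    with R have "R > 0" by simp
    \<comment> \<open>The quadratic polynomial in \<open>t\<close> attains its minimum at \<open>1 / R\<close>.\<close>
    then show ?thesis using quad[of "1 / R"] by (simp add: field_simps power2_eq_square)
  qed
  then show ?thesis by (simp add: w_def z_def P_def R_def)
qed

end

context
  fixes \<phi> :: "'a::unital_cstar_algebra \<Rightarrow> complex"
  assumes \<phi>: "positive_functional \<phi>"
begin

lemma positive_functional_nonneg: "nonneg x \<Longrightarrow> 0 \<le> \<phi> x"
  using \<phi> unfolding nonneg_def positive_functional_def by metis

lemma positive_functional_mono: "nonneg (y - x) \<Longrightarrow> Re (\<phi> x) \<le> Re (\<phi> y)"
  using positive_functional_nonneg[of "y - x"] positive_functional_diff[OF \<phi>]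
  by (simp add: less_eq_complex_def)

text \<open>
  The element \<open>\<parallel>a\<parallel>\<^sup>2 - a\<^sup>* a\<close> is a square \<open>w\<^sup>2\<close>, and \<open>b\<^sup>* w\<^sup>2 b\<close> has the form \<open>y\<^sup>* y\<close>.
\<close>

lemma positive_functional_sandwich_le:
  "Re (\<phi> (star b * (star a * a) * b)) \<le> (norm a)\<^sup>2 * Re (\<phi> (star b * b))"
proof -
  have "nonneg ((norm a)\<^sup>2 *\<^sub>R 1 - star a * a)"
    by (rule nonneg_scalar_minus) (simp_all add: star_simps cstar_identity)
  then obtain w where w: "star w = w" "(norm a)\<^sup>2 *\<^sub>R 1 - star a * a = w * w"
    by (auto simp: nonneg_def)
  have "0 \<le> Re (\<phi> (star (w * b) * (w * b)))" by (rule positive_functional_Re[OF \<phi>])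
  also have "star (w * b) * (w * b) = star b * (w * w) * b" by (simp add: star_mult w mult.assoc)
  also have "\<dots> = (norm a)\<^sup>2 *\<^sub>R (star b * b) - star b * (star a * a) * b"
    by (simp add: w(2)[symmetric] algebra_simps)
  finally show ?thesis by (simp add: positive_functional_linear[OF \<phi>])
qed

lemma positive_functional_star: "\<phi> (star x) = cnj (\<phi> x)"
  using positive_functional_hermitian[OF \<phi>, of x 1] by simp

lemma positive_functional_norm_le: "cmod (\<phi> x) \<le> norm x * Re (\<phi> 1)"
proof (rule power2_le_imp_le)
  have "(cmod (\<phi> x))\<^sup>2 \<le> Re (\<phi> 1) * Re (\<phi> (star x * x))"
    using positive_functional_Cauchy_Schwarz[OF \<phi>, of 1 x] by simp
  also have "\<dots> \<le> Re (\<phi> 1) * ((norm x)\<^sup>2 * Re (\<phi> 1))"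
    using positive_functional_sandwich_le[of 1 x] positive_functional_nonneg[of 1]
    by (intro mult_left_mono) (simp_all add: less_eq_complex_def)
  finally show "(cmod (\<phi> x))\<^sup>2 \<le> (norm x * Re (\<phi> 1))\<^sup>2" by (simp add: power2_eq_square mult_ac)
  show "0 \<le> norm x * Re (\<phi> 1)"
    using positive_functional_nonneg[of 1] by (simp add: less_eq_complex_def)
qed

end

text \<open>
  The positive functionals of norm at most \<open>1\<close>. Unlike the states, they form a weak* compact
  set even if the algebra has no unit.
\<close>

definition quasi_states :: "('a::cstar_algebra \<Rightarrow> complex) set" where
  "quasi_states = {\<phi>. positive_functional \<phi> \<and> (\<forall>x. cmod (\<phi> x) \<le> norm x)}"

definition unital_extension :: "('a::cstar_algebra \<Rightarrow> complex) \<Rightarrow> 'a unitization \<Rightarrow> complex" where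
  "unital_extension \<phi> x = \<phi> (alg_part x) + scalar_part x"

lemma unital_extension_unitize [simp]: "unital_extension \<phi> (unitize a) = \<phi> a"
  by (simp add: unital_extension_def)

lemma quasi_state_bounded_linear:
  assumes "\<phi> \<in> quasi_states"
  shows "bounded_linear \<phi>"
proof (rule bounded_linear_intro[of _ 1])
  have \<phi>: "positive_functional \<phi>" using assms by (simp add: quasi_states_def)
  show "\<phi> (x + y) = \<phi> x + \<phi> y" "\<phi> (r *\<^sub>R x) = r *\<^sub>R \<phi> x" for x y r
    by (simp_all add: positive_functional_linear[OF \<phi>])
  show "cmod (\<phi> x) \<le> norm x * 1" for x using assms by (simp add: quasi_states_def)
qed

text \<open>
  The hermitian symmetry is available at products \<open>e a\<close>, and \<open>a\<close> is a limit of such products.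
\<close>

lemma quasi_state_star:
  assumes "\<phi> \<in> quasi_states"
  shows "\<phi> (star a) = cnj (\<phi> a)"
proof -
  have \<phi>: "positive_functional \<phi>" using assms by (simp add: quasi_states_def)
  note bl = quasi_state_bounded_linear[OF assms]
  obtain e where e: "(\<lambda>n. e n * a) \<longlonglongrightarrow> a" by (rule approximate_left_unit)
  have "(\<lambda>n. \<phi> (star (e n * a))) \<longlonglongrightarrow> \<phi> (star a)"
    by (intro bounded_linear.tendsto[OF bl] bounded_linear.tendsto[OF bounded_linear_star] e)
  moreover have "(\<lambda>n. cnj (\<phi> (e n * a))) \<longlonglongrightarrow> cnj (\<phi> a)"
    by (intro tendsto_cnj bounded_linear.tendsto[OF bl] e)
  moreover have "\<phi> (star (e n * a)) = cnj (\<phi> (e n * a))" for n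
    using positive_functional_hermitian[OF \<phi>, of a "star (e n)"] by (simp add: star_mult star_star)
  ultimately show ?thesis using LIMSEQ_unique by fastforce
qed

text \<open>
  Again by approximation: \<open>\<bar>\<phi>(e a)\<bar>\<^sup>2 \<le> \<phi>(e e\<^sup>*) \<phi>(a\<^sup>* a)\<close>, and the first factor is at most \<open>1\<close>
  when \<open>\<parallel>e\<parallel> \<le> 1\<close>.
\<close>

lemma quasi_state_Cauchy_Schwarz:
  assumes "\<phi> \<in> quasi_states"
  shows "(cmod (\<phi> a))\<^sup>2 \<le> Re (\<phi> (star a * a))"
proof -
  have \<phi>: "positive_functional \<phi>" and n: "cmod (\<phi> x) \<le> norm x" for x
    using assms by (simp_all add: quasi_states_def)
  note bl = quasi_state_bounded_linear[OF assms]
  obtain e where ne: "\<And>n. norm (e n) \<le> 1" and e: "(\<lambda>n. e n * a) \<longlonglongrightarrow> a"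
    using approximate_left_unit by blast
  have "(\<lambda>n. (cmod (\<phi> (e n * a)))\<^sup>2) \<longlonglongrightarrow> (cmod (\<phi> a))\<^sup>2"
    by (intro tendsto_intros bounded_linear.tendsto[OF bl] e)
  moreover have "(cmod (\<phi> (e n * a)))\<^sup>2 \<le> Re (\<phi> (star a * a))" for n
  proof -
    have "(cmod (\<phi> (e n * a)))\<^sup>2 \<le> Re (\<phi> (e n * star (e n))) * Re (\<phi> (star a * a))"
      using positive_functional_Cauchy_Schwarz[OF \<phi>, of "star (e n)" a] by (simp add: star_star)
    also have "Re (\<phi> (e n * star (e n))) \<le> 1"
    proof -
      have "Re (\<phi> (e n * star (e n))) \<le> norm (e n * star (e n))"
        using n complex_Re_le_cmod order_trans by blast
      also have "\<dots> \<le> 1" using ne[of n] by (simp add: cstar_identity' power_le_one)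
      finally show ?thesis .
    qed
    finally show ?thesis
      using positive_functional_Re[OF \<phi>, of a] by (simp add: mult_right_mono)
  qed
  ultimately show ?thesis by (intro LIMSEQ_le_const2) auto
qed

text \<open>
  The value at \<open>(a + l)\<^sup>* (a + l)\<close> is at least \<open>(\<bar>\<phi>(a)\<bar> - \<bar>l\<bar>)\<^sup>2\<close> by the preceding inequality.
  Thanks to this extension, all estimates for functionals can be made in an algebra with a
  unit.
\<close>

lemma positive_unital_extension:
  assumes "\<phi> \<in> quasi_states"
  shows "positive_functional (unital_extension \<phi>)" "unital_extension \<phi> 1 = 1"
proof -
  have \<phi>: "positive_functional \<phi>" using assms by (simp add: quasi_states_def)
  show "unital_extension \<phi> 1 = 1"
    by (simp add: unital_extension_def one_unitization_def positive_functional_zero[OF \<phi>])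
  show "positive_functional (unital_extension \<phi>)"
    unfolding positive_functional_def
  proof (intro conjI allI)
    fix x y :: "'a unitization" and c :: complex
    show "unital_extension \<phi> (x + y) = unital_extension \<phi> x + unital_extension \<phi> y"
      by (simp add: unital_extension_def plus_unitization_def positive_functional_linear[OF \<phi>])
    show "unital_extension \<phi> (c *\<^sub>C x) = c * unital_extension \<phi> x"
      by (simp add: unital_extension_def scaleC_unitization_def positive_functional_linear[OF \<phi>] algebra_simps)
    obtain a l where x: "x = Unit a l" by (cases x)
    define z where "z = cnj l * \<phi> a"
    have eq: "unital_extension \<phi> (star x * x) = \<phi> (star a * a) + (z + cnj z) + cnj l * l"
      by (simp add: x z_def unital_extension_def star_unitization_def times_unitization_def
          positive_functional_linear[OF \<phi>] quasi_state_star[OF assms])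
    have "\<bar>Re z\<bar> \<le> cmod l * cmod (\<phi> a)"
      using abs_Re_le_cmod[of z] by (simp add: z_def norm_mult)
    moreover have "(cmod (\<phi> a) - cmod l)\<^sup>2 \<ge> 0" by simp
    moreover have "Re (cnj l * l) = (cmod l)\<^sup>2" by (simp add: cmod_power2 flip: power2_eq_square)
    ultimately have "0 \<le> Re (unital_extension \<phi> (star x * x))"
      using quasi_state_Cauchy_Schwarz[OF assms, of a]
      unfolding eq plus_complex.sel power2_diff cnj.sel by argo
    moreover have "Im (unital_extension \<phi> (star x * x)) = 0"
      unfolding eq by (simp add: positive_functional_Im[OF \<phi>])
    ultimately show "0 \<le> unital_extension \<phi> (star x * x)" by (simp add: less_eq_complex_def)
  qed
qed

lemma state_imp_quasi_state:
  assumes "\<phi> \<in> states"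
  shows "\<phi> \<in> quasi_states"
proof -
  have bl: "bounded_linear \<phi>" and on: "onorm \<phi> = 1" using assms by (simp_all add: states_def)
  have "cmod (\<phi> x) \<le> norm x" for x using onorm[OF bl, of x] by (simp add: on)
  moreover have "positive_functional \<phi>"
    using assms linear_add[OF bounded_linear.linear[OF bl]] by (simp add: states_def positive_functional_def)
  ultimately show ?thesis by (simp add: quasi_states_def)
qed

section \<open>Existence of norming states\<close>

definition sublinear :: "('a::real_vector \<Rightarrow> real) \<Rightarrow> bool" where
  "sublinear q \<longleftrightarrow> (\<forall>x y. q (x + y) \<le> q x + q y) \<and> (\<forall>r\<ge>0. \<forall>x. q (r *\<^sub>R x) = r * q x)"

lemma sublinearD:
  assumes "sublinear q"
  shows "q (x + y) \<le> q x + q y" "r \<ge> 0 \<Longrightarrow> q (r *\<^sub>R x) = r * q x" "q 0 = 0" "- q (- x) \<le> q x"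
proof -
  show add: "q (x + y) \<le> q x + q y" for x y using assms by (simp add: sublinear_def)
  show hom: "r \<ge> 0 \<Longrightarrow> q (r *\<^sub>R x) = r * q x" for r x using assms by (simp add: sublinear_def)
  show zero: "q 0 = 0" using hom[of 0 0] by simp
  show "- q (- x) \<le> q x" using add[of x "- x"] zero by simp
qed

lemma sublinearI:
  assumes add: "\<And>x y. q (x + y) \<le> q x + q y" and hom: "\<And>r x. r > 0 \<Longrightarrow> q (r *\<^sub>R x) \<le> r * q x"
    and zero: "q 0 = 0"
  shows "sublinear q"
proof -
  have "q (r *\<^sub>R x) = r * q x" if "r \<ge> 0" for r x
  proof (cases "r = 0")
    case False
    with that have r: "r > 0" by simp
    have "q (inverse r *\<^sub>R (r *\<^sub>R x)) \<le> inverse r * q (r *\<^sub>R x)" using r by (intro hom) simp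
    then have "r * q x \<le> q (r *\<^sub>R x)" using r by (simp add: field_simps)
    with hom[OF r, of x] show ?thesis by simp
  qed (simp add: zero)
  with add show ?thesis by (simp add: sublinear_def)
qed

text \<open>
  The inequalities \<open>add\<close> and \<open>hom\<close> may pass to another member of the family. So the lemma
  applies to chains of sublinear functions as well as to families whose single members are not
  sublinear.
\<close>

lemma sublinear_INF:
  fixes q :: "'i \<Rightarrow> 'a::real_vector \<Rightarrow> real"
  assumes ne: "I \<noteq> {}"
    and bdd: "\<And>x. bdd_below ((\<lambda>i. q i x) ` I)"
    and add: "\<And>i j x y. i \<in> I \<Longrightarrow> j \<in> I \<Longrightarrow> \<exists>k\<in>I. q k (x + y) \<le> q i x + q j y"
    and hom: "\<And>i r x. i \<in> I \<Longrightarrow> r > 0 \<Longrightarrow> \<exists>k\<in>I. q k (r *\<^sub>R x) \<le> r * q i x"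
    and zero: "(INF i\<in>I. q i 0) = 0"
  shows "sublinear (\<lambda>x. INF i\<in>I. q i x)"
proof (rule sublinearI)
  show "(INF i\<in>I. q i 0) = 0" by (rule zero)
next
  let ?u = "\<lambda>x. INF i\<in>I. q i x"
  fix x y :: 'a
  have "?u (x + y) - q i x \<le> ?u y" if "i \<in> I" for i
  proof (rule cINF_greatest[OF ne])
    fix j assume "j \<in> I"
    with that add obtain k where k: "k \<in> I" "q k (x + y) \<le> q i x + q j y" by blast
    then have "?u (x + y) \<le> q k (x + y)" by (intro cINF_lower bdd)
    with k show "?u (x + y) - q i x \<le> q j y" by simp
  qed
  then have "?u (x + y) - ?u y \<le> q i x" if "i \<in> I" for i using that by (simp add: algebra_simps)
  then have "?u (x + y) - ?u y \<le> ?u x" by (intro cINF_greatest ne)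
  then show "?u (x + y) \<le> ?u x + ?u y" by simp
next
  let ?u = "\<lambda>x. INF i\<in>I. q i x"
  fix r :: real and x :: 'a assume r: "r > 0"
  have "?u (r *\<^sub>R x) / r \<le> ?u x"
  proof (rule cINF_greatest[OF ne])
    fix i assume "i \<in> I"
    with hom r obtain k where k: "k \<in> I" "q k (r *\<^sub>R x) \<le> r * q i x" by blast
    then have "?u (r *\<^sub>R x) \<le> q k (r *\<^sub>R x)" by (intro cINF_lower bdd)
    with k r show "?u (r *\<^sub>R x) / r \<le> q i x" by (simp add: field_simps)
  qed
  with r show "?u (r *\<^sub>R x) \<le> r * ?u x" by (simp add: field_simps)
qed

text \<open>
  The function \<open>q'(z) = inf {q(z + t y) - t q(y) | t \<ge> 0}\<close> is the device behind both uses of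
  this lemma: it equals \<open>q\<close> if \<open>q\<close> is minimal, which forces additivity in the direction \<open>y\<close>,
  and it satisfies \<open>q'(-y) \<le> -q(y)\<close>, which prescribes the value at \<open>y\<close> of every linear
  functional below \<open>q'\<close>.
\<close>

lemma sublinear_tilt:
  fixes q :: "'a::real_vector \<Rightarrow> real"
  assumes q: "sublinear q"
  obtains q' where "sublinear q'" "q' \<le> q" "\<And>z. q' z \<le> q (z + y) - q y"
proof
  note D = sublinearD[OF q]
  define f where "f t z = q (z + t *\<^sub>R y) - t * q y" for t z
  let ?q = "\<lambda>z. INF t\<in>{0..}. f t z"
  have low: "- q (- z) \<le> f t z" if "t \<in> {0..}" for t z
    using D(1)[of "z + t *\<^sub>R y" "- z"] D(2)[of t y] that by (simp add: f_def)
  have bdd: "bdd_below ((\<lambda>t. f t z) ` {0..})" for z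
    using low by (auto intro!: bdd_belowI2)
  have upper: "?q z \<le> f t z" if "t \<ge> 0" for t z
    using that by (intro cINF_lower bdd) simp
  show "?q \<le> q"
    using upper[of 0] by (simp add: le_fun_def f_def)
  show "?q z \<le> q (z + y) - q y" for z
    using upper[of 1 z] by (simp add: f_def)
  show "sublinear ?q"
  proof (rule sublinear_INF[OF _ bdd])
    fix s t :: real and z w assume st: "s \<in> {0..}" "t \<in> {0..}"
    have "f (s + t) (z + w) \<le> f s z + f t w"
      using D(1)[of "z + s *\<^sub>R y" "w + t *\<^sub>R y"] by (simp add: f_def algebra_simps)
    then show "\<exists>k\<in>{0..}. f k (z + w) \<le> f s z + f t w"
      using st by (intro bexI[of _ "s + t"]) simp_all
  next
    fix t r :: real and z assume tr: "t \<in> {0..}" "r > 0"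
    have "f (r * t) (r *\<^sub>R z) \<le> r * f t z"
      using D(2)[of r "z + t *\<^sub>R y"] tr by (simp add: f_def algebra_simps)
    then show "\<exists>k\<in>{0..}. f k (r *\<^sub>R z) \<le> r * f t z"
      using tr by (intro bexI[of _ "r * t"]) simp_all
  next
    show "?q 0 = 0"
    proof (rule antisym)
      show "?q 0 \<le> 0" using upper[of 0 0] by (simp add: f_def D)
      show "0 \<le> ?q 0" using low[of _ 0] by (intro cINF_greatest) (simp_all add: D(3))
    qed
  qed simp
qed

lemma minimal_sublinear_linear:
  fixes q :: "'a::real_vector \<Rightarrow> real"
  assumes q: "sublinear q" and min: "\<And>q'. sublinear q' \<Longrightarrow> q' \<le> q \<Longrightarrow> q' = q"
  shows "linear q"
proof -
  note D = sublinearD[OF q]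
  have add: "q (z + y) = q z + q y" for z y
  proof -
    obtain q' where "sublinear q'" "q' \<le> q" "\<And>z. q' z \<le> q (z + y) - q y"
      using sublinear_tilt[OF q, of y] by metis
    with min have "q z \<le> q (z + y) - q y" by metis
    then show ?thesis using D(1)[of z y] by simp
  qed
  have neg: "q (- x) = - q x" for x using add[of x "- x"] D(3) by simp
  show ?thesis
  proof (rule linearI)
    fix r :: real and x
    show "q (r *\<^sub>R x) = r *\<^sub>R q x"
    proof (cases "r \<ge> 0")
      case False
      then have "q ((- r) *\<^sub>R x) = (- r) * q x" by (intro D) simp
      then show ?thesis by (simp add: neg)
    qed (simp add: D)
  qed (rule add)
qed

lemma exists_minimal_sublinear:
  fixes p :: "'a::real_vector \<Rightarrow> real"
  assumes p: "sublinear p"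
  obtains q where "sublinear q" "q \<le> p" "\<And>q'. sublinear q' \<Longrightarrow> q' \<le> q \<Longrightarrow> q' = q"
proof -
  let ?A = "{q. sublinear q \<and> q \<le> p}"
  have "\<exists>m\<in>?A. \<forall>a\<in>?A. m \<ge> a \<longrightarrow> a = m"
  proof (rule predicate_Zorn)
    show "partial_order_on ?A (relation_of (\<ge>) ?A)"
      by (auto simp: partial_order_on_def preorder_on_def refl_on_def trans_def antisym_def relation_of_def)
  next
    fix C assume C: "C \<in> Chains (relation_of (\<ge>) ?A)"
    have sub: "q \<in> ?A" if "q \<in> C" for q
      using C that by (auto simp: Chains_def relation_of_def)
    have chain: "q \<le> q' \<or> q' \<le> q" if "q \<in> C" "q' \<in> C" for q q'
      using C that by (auto simp: Chains_def relation_of_def)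
    show "\<exists>u\<in>?A. \<forall>a\<in>C. u \<le> a"
    proof (cases "C = {}")
      case True
      then show ?thesis using p by auto
    next
      case False
      let ?u = "\<lambda>x. INF q\<in>C. q x"
      have low: "- p (- x) \<le> q x" if "q \<in> C" for q x
        using sub[OF that] sublinearD(4)[of q x] by (auto simp: le_fun_def) (meson le_minus_iff minus_le_iff order_trans)
      have bdd: "bdd_below ((\<lambda>q. q x) ` C)" for x
        using low by (auto intro!: bdd_belowI2)
      have "sublinear ?u"
      proof (rule sublinear_INF[OF False bdd])
        fix q q' x y assume qq: "q \<in> C" "q' \<in> C"
        from chain[OF qq] show "\<exists>k\<in>C. k (x + y) \<le> q x + q' y"
        proof
          assume "q \<le> q'"
          then have "q (x + y) \<le> q x + q' y"
            using sublinearD(1)[of q x y] sub[OF qq(1)] by (simp add: le_fun_def) (meson add_left_mono order_trans)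
          with qq show ?thesis by blast
        next
          assume "q' \<le> q"
          then have "q' (x + y) \<le> q x + q' y"
            using sublinearD(1)[of q' x y] sub[OF qq(2)] by (simp add: le_fun_def) (meson add_right_mono order_trans)
          with qq show ?thesis by blast
        qed
      next
        fix q and r :: real and x assume "q \<in> C" "r > 0"
        then show "\<exists>k\<in>C. k (r *\<^sub>R x) \<le> r * q x"
          using sublinearD(2)[of q r x] sub[of q] by (intro bexI[of _ q]) auto
      next
        have "q 0 = 0" if "q \<in> C" for q using sub[OF that] sublinearD(3) by blast
        then have "(INF q\<in>C. q 0) = (INF q\<in>C. 0)" by (intro INF_cong refl)
        then show "(INF q\<in>C. q 0) = 0" using False by simp
      qed
      moreover have le: "?u \<le> q" if "q \<in> C" for q
        using that by (auto simp: le_fun_def intro!: cINF_lower bdd)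
      moreover have "?u \<le> p"
        using False le sub by (metis (no_types, lifting) all_not_in_conv mem_Collect_eq order_trans)
      ultimately show ?thesis by blast
    qed
  qed
  then obtain m where m: "sublinear m" "m \<le> p" "\<And>a. sublinear a \<Longrightarrow> a \<le> p \<Longrightarrow> a \<le> m \<Longrightarrow> a = m"
    by auto
  show thesis using that[of m] m order_trans by metis
qed

text \<open>
  A minimal sublinear functional is linear, and Zorn's lemma provides one below the tilt of
  \<open>p\<close> in the direction \<open>x0\<close>.
\<close>

theorem Hahn_Banach_sublinear:
  fixes p :: "'a::real_vector \<Rightarrow> real"
  assumes p: "sublinear p"
  obtains f where "linear f" "\<And>x. f x \<le> p x" "f x0 = p x0"
proof -
  obtain p' where p': "sublinear p'" "p' \<le> p" "\<And>z. p' z \<le> p (z + x0) - p x0"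
    using sublinear_tilt[OF p, of x0] by metis
  obtain f where f: "sublinear f" "f \<le> p'" "\<And>q'. sublinear q' \<Longrightarrow> q' \<le> f \<Longrightarrow> q' = f"
    using exists_minimal_sublinear[OF p'(1)] by metis
  have lin: "linear f" using f(1,3) by (rule minimal_sublinear_linear)
  have le: "f x \<le> p x" for x using f(2) p'(2) by (meson le_funD order_trans)
  have "f (- x0) \<le> p' (- x0)" using f(2) by (rule le_funD)
  also have "\<dots> \<le> - p x0" using p'(3)[of "- x0"] sublinearD(3)[OF p] by simp
  finally have "p x0 \<le> f x0" using linear_neg[OF lin, of x0] by simp
  with le[of x0] show thesis using that[OF lin le] by simp
qed

text \<open>
  The supremum of the real part of the numerical range of \<open>y\<close> in the unitization. The
  expression under the infimum decreases in \<open>r\<close>, and its limit is the derivative of the norm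
  at \<open>1\<close> in the direction \<open>y\<close>. A real linear functional dominated by it is the real part of a
  positive functional of norm at most \<open>1\<close>.
\<close>

definition numerical_sup :: "'a::cstar_algebra \<Rightarrow> real" where
  "numerical_sup y = (INF r\<in>{0..}. norm (r *\<^sub>R 1 + unitize y) - r)"

lemma numerical_sup_le: "r \<ge> 0 \<Longrightarrow> numerical_sup y \<le> norm (r *\<^sub>R 1 + unitize y) - r"
  and numerical_sup_bdd: "bdd_below ((\<lambda>r. norm (r *\<^sub>R 1 + unitize y) - r) ` {0..})"
proof -
  have "- norm y \<le> norm (r *\<^sub>R 1 + unitize y) - r" if "r \<ge> 0" for r
    using norm_triangle_ineq2[of "r *\<^sub>R 1" "- unitize y"] that by simp
  then show bdd: "bdd_below ((\<lambda>r. norm (r *\<^sub>R 1 + unitize y) - r) ` {0..})"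
    by (auto intro!: bdd_belowI2)
  show "r \<ge> 0 \<Longrightarrow> numerical_sup y \<le> norm (r *\<^sub>R 1 + unitize y) - r"
    unfolding numerical_sup_def by (rule cINF_lower[OF bdd]) simp
qed

lemma numerical_sup_le_norm: "numerical_sup y \<le> norm y"
  using numerical_sup_le[of 0 y] by simp

lemma sublinear_numerical_sup: "sublinear (numerical_sup :: 'a::cstar_algebra \<Rightarrow> real)"
proof -
  let ?f = "\<lambda>r (y::'a). norm (r *\<^sub>R 1 + unitize y) - r"
  have "sublinear (\<lambda>y. INF r\<in>{0..}. ?f r y)"
  proof (rule sublinear_INF[OF _ numerical_sup_bdd])
    fix s t :: real and z w :: 'a assume st: "s \<in> {0..}" "t \<in> {0..}"
    have "?f (s + t) (z + w) \<le> ?f s z + ?f t w"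
      using norm_triangle_ineq[of "s *\<^sub>R 1 + unitize z" "t *\<^sub>R 1 + unitize w"]
      by (simp add: unitize_simps algebra_simps)
    then show "\<exists>k\<in>{0..}. ?f k (z + w) \<le> ?f s z + ?f t w"
      using st by (intro bexI[of _ "s + t"]) simp_all
  next
    fix t r :: real and z :: 'a assume tr: "t \<in> {0..}" "r > 0"
    have "(r * t) *\<^sub>R 1 + unitize (r *\<^sub>R z) = r *\<^sub>R (t *\<^sub>R 1 + unitize z)"
      by (simp add: unitize_simps algebra_simps)
    then have "?f (r * t) (r *\<^sub>R z) = r * ?f t z"
      using tr by (simp only: norm_scaleR) (simp add: right_diff_distrib)
    then show "\<exists>k\<in>{0..}. ?f k (r *\<^sub>R z) \<le> r * ?f t z"
      using tr by (intro bexI[of _ "r * t"]) simp_all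
  next
    have "?f r 0 = 0" if "r \<in> {0..}" for r using that by (simp add: unitize_simps)
    then have "(INF r\<in>{0..}. ?f r 0) = (INF r\<in>{0::real..}. 0)" by (intro INF_cong refl)
    then show "(INF r\<in>{0..}. ?f r 0) = 0" by simp
  qed simp
  then show ?thesis by (simp add: numerical_sup_def[abs_def])
qed

lemma numerical_sup_nonpos_square: "numerical_sup (- (star z * z)) \<le> 0"
proof -
  have "nonneg (star (unitize z) * unitize z)" by (rule nonneg_star_mult_self)
  then have "norm (norm (star z * z) *\<^sub>R 1 - star (unitize z) * unitize z) \<le> norm (star z * z)"
    by (rule nonneg_norm_scalar_minus_le) (simp flip: unitize_simps)
  then show ?thesis
    using numerical_sup_le[of "norm (star z * z)" "- (star z * z)"] by (simp add: unitize_simps)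
qed

text \<open>
  Since \<open>r + \<i> k\<close> is normal, \<open>\<parallel>r + \<i> k\<parallel>\<^sup>2 \<le> r\<^sup>2 + \<parallel>k\<parallel>\<^sup>2\<close>, and \<open>sqrt (r\<^sup>2 + \<parallel>k\<parallel>\<^sup>2) - r\<close> tends to \<open>0\<close>
  for large \<open>r\<close>.
\<close>

lemma numerical_sup_skew_nonpos:
  fixes k :: "'a::cstar_algebra"
  assumes k: "star k = k"
  shows "numerical_sup (\<i> *\<^sub>C k) \<le> 0"
proof (rule field_le_epsilon)
  fix e :: real assume e: "e > 0"
  \<comment> \<open>With this \<open>r\<close>, \<open>2 r e = K\<close>, so that \<open>r\<^sup>2 + K \<le> (r + e)\<^sup>2\<close>.\<close>
  define K r where "K = (norm k)\<^sup>2" and "r = K / (2 * e)"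
  have r: "r \<ge> 0" using e by (simp add: r_def K_def)
  let ?w = "r *\<^sub>R 1 + unitize (\<i> *\<^sub>C k)"
  have "star ?w * ?w = r\<^sup>2 *\<^sub>R 1 + unitize (k * k)"
    by (simp add: unitize_simps star_simps k[THEN arg_cong[where f=unitize], unfolded unitize_simps]
        scaleC_minus_left scaleC_diff_right algebra_simps mult_scaleC_left mult_scaleC_right power2_eq_square)
       (simp add: scaleR_scaleC scaleC_scaleC mult.commute)
  then have "(norm ?w)\<^sup>2 = norm (r\<^sup>2 *\<^sub>R 1 + unitize (k * k))"
    by (simp flip: cstar_identity)
  also have "\<dots> \<le> r\<^sup>2 + K"
    using norm_triangle_ineq[of "r\<^sup>2 *\<^sub>R 1" "unitize (k * k)"] norm_square_selfadjoint[OF k]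
    by (simp add: K_def)
  also have "\<dots> \<le> (r + e)\<^sup>2"
    using e by (simp add: power2_sum r_def)
  finally have "norm ?w \<le> r + e" by (rule power2_le_imp_le) (use r e in simp)
  then show "numerical_sup (\<i> *\<^sub>C k) \<le> 0 + e"
    using numerical_sup_le[OF r, of "\<i> *\<^sub>C k"] by simp
qed

text \<open>
  If both values were smaller than \<open>\<parallel>x\<parallel>\<close>, then \<open>\<beta> - x\<close> and \<open>\<beta> + x\<close> would be nonnegative for
  some \<open>\<beta> < \<parallel>x\<parallel>\<close>.
\<close>

lemma norm_le_numerical_sup:
  fixes x :: "'a::cstar_algebra"
  assumes x: "star x = x"
  shows "norm x \<le> max (numerical_sup x) (numerical_sup (- x))"
proof (rule ccontr)
  assume "\<not> ?thesis"
  then have lt: "numerical_sup x < norm x" "numerical_sup (- x) < norm x" by auto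
  let ?x = "unitize x"
  have sx: "star ?x = ?x" by (simp add: x flip: unitize_simps)
  obtain r s where r: "r \<ge> 0" "norm (r *\<^sub>R 1 + ?x) - r < norm x"
    and s: "s \<ge> 0" "norm (s *\<^sub>R 1 - ?x) - s < norm x"
    using lt cINF_less_iff[OF _ numerical_sup_bdd, of x "norm x"] cINF_less_iff[OF _ numerical_sup_bdd, of "- x" "norm x"]
    unfolding numerical_sup_def by (auto simp: unitize_simps)
  have "0 < norm x" using lt(1) sublinearD(3)[OF sublinear_numerical_sup[where 'a='a]] by (cases "x = 0") auto
  define \<beta> where "\<beta> = max 0 (max (norm (r *\<^sub>R 1 + ?x) - r) (norm (s *\<^sub>R 1 - ?x) - s))"
  have \<beta>: "0 \<le> \<beta>" "\<beta> < norm x" "norm (r *\<^sub>R 1 + ?x) \<le> r + \<beta>" "norm (s *\<^sub>R 1 - ?x) \<le> s + \<beta>"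
    using r s \<open>0 < norm x\<close> by (auto simp: \<beta>_def)
  have "nonneg ((r + \<beta>) *\<^sub>R 1 - (r *\<^sub>R 1 + ?x))"
    by (intro nonneg_scalar_minus \<beta>) (simp add: star_simps sx)
  then have 1: "nonneg (\<beta> *\<^sub>R 1 - ?x)" by (simp add: algebra_simps)
  have "nonneg ((s + \<beta>) *\<^sub>R 1 - (s *\<^sub>R 1 - ?x))"
    by (intro nonneg_scalar_minus \<beta>) (simp add: star_simps sx)
  then have 2: "nonneg (\<beta> *\<^sub>R 1 + ?x)" by (simp add: algebra_simps)
  have "norm ?x \<le> \<bar>\<beta>\<bar>" by (rule selfadjoint_norm_le_if_nonneg[OF sx 1 2])
  with \<beta> show False by simp
qed

text \<open>
  The functional \<open>f\<close> vanishes at \<open>\<i> k\<close> for self-adjoint \<open>k\<close>, since the bound is nonpositive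
  there and at its negative. So \<open>f\<close> is the real part of a complex linear functional that is
  real and nonnegative at \<open>z\<^sup>* z\<close>.
\<close>

lemma numerical_sup_dominated_quasi_state:
  fixes f :: "'a::cstar_algebra \<Rightarrow> real"
  assumes lin: "linear f" and le: "\<And>y. f y \<le> numerical_sup y"
  shows "(\<lambda>a. Complex (f a) (- f (\<i> *\<^sub>C a))) \<in> quasi_states"
proof -
  let ?\<phi> = "\<lambda>a. Complex (f a) (- f (\<i> *\<^sub>C a))"
  note lin_simps = linear_add[OF lin] linear_scale[OF lin] linear_neg[OF lin]
  have skew: "f (\<i> *\<^sub>C k) = 0" if "star k = k" for k
    using le[of "\<i> *\<^sub>C k"] le[of "\<i> *\<^sub>C (- k)"] numerical_sup_skew_nonpos[OF that]
      numerical_sup_skew_nonpos[of "- k"] that by (simp add: star_simps scaleC_minus_right lin_simps)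
  have cs: "c *\<^sub>C a = Re c *\<^sub>R a + Im c *\<^sub>R \<i> *\<^sub>C a" for c and a :: 'a
    by (simp add: scaleR_scaleC scaleC_scaleC complex_eq[symmetric] mult.commute flip: scaleC_add_left)
  have scaleC: "?\<phi> (c *\<^sub>C a) = c * ?\<phi> a" for c a
  proof -
    have "\<i> *\<^sub>C c *\<^sub>C a = Re c *\<^sub>R \<i> *\<^sub>C a - Im c *\<^sub>R a"
      unfolding cs[of c a] by (simp add: scaleC_add_right scaleR_scaleC scaleC_scaleC scaleC_minus_left mult.commute mult.assoc)
    then show ?thesis
      by (simp add: complex_eq_iff lin_simps cs[of c a] linear_diff[OF lin])
  qed
  have "positive_functional ?\<phi>"
    unfolding positive_functional_def
  proof (intro conjI allI)
    show "?\<phi> (x + y) = ?\<phi> x + ?\<phi> y" for x y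
      by (simp add: complex_eq_iff scaleC_add_right lin_simps)
    show "?\<phi> (c *\<^sub>C a) = c * ?\<phi> a" for c a by (rule scaleC)
    show "0 \<le> ?\<phi> (star z * z)" for z
      using le[of "- (star z * z)"] numerical_sup_nonpos_square[of z] skew[of "star z * z"]
      by (simp add: less_eq_complex_def lin_simps star_simps)
  qed
  moreover have "cmod (?\<phi> a) \<le> norm a" for a
  proof (cases "?\<phi> a = 0")
    case False
    \<comment> \<open>Rotating \<open>a\<close> by the phase \<open>c\<close> makes the value of the functional real and
        nonnegative.\<close>
    define c where "c = cnj (?\<phi> a) / of_real (cmod (?\<phi> a))"
    have "cmod c = 1" using False by (simp add: c_def norm_divide)
    have "c * ?\<phi> a = of_real (cmod (?\<phi> a))"
      using False complex_norm_square[of "?\<phi> a"] by (simp add: c_def field_simps power2_eq_square)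
    then have "cmod (?\<phi> a) = Re (?\<phi> (c *\<^sub>C a))"
      unfolding scaleC by simp
    also have "\<dots> = f (c *\<^sub>C a)" by simp
    also have "\<dots> \<le> norm (c *\<^sub>C a)" using le numerical_sup_le_norm order_trans by blast
    also have "\<dots> = norm a" using \<open>cmod c = 1\<close> by (simp add: norm_scaleC)
    finally show ?thesis .
  qed simp
  ultimately show ?thesis by (simp add: quasi_states_def)
qed

theorem exists_norming_quasi_state:
  fixes x :: "'a::cstar_algebra"
  assumes x: "star x = x"
  shows "\<exists>\<phi>\<in>quasi_states. norm x \<le> cmod (\<phi> x)"
proof -
  have main: "\<exists>\<phi>\<in>quasi_states. numerical_sup y \<le> Re (\<phi> y)" for y :: 'a
  proof -
    obtain f where "linear f" "\<And>x. f x \<le> numerical_sup x" "f y = numerical_sup y"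
      using Hahn_Banach_sublinear[OF sublinear_numerical_sup] by metis
    then show ?thesis
      using numerical_sup_dominated_quasi_state[of f] by (intro bexI) auto
  qed
  obtain y where y: "y = x \<or> y = - x" and le: "norm x \<le> numerical_sup y"
    using norm_le_numerical_sup[OF x] by (auto simp: max_def split: if_splits)
  obtain \<phi> where \<phi>: "\<phi> \<in> quasi_states" "numerical_sup y \<le> Re (\<phi> y)" using main by blast
  have "cmod (\<phi> y) = cmod (\<phi> x)"
    using y \<phi>(1) positive_functional_minus[of \<phi> x] by (auto simp: quasi_states_def)
  then show ?thesis using \<phi> le complex_Re_le_cmod[of "\<phi> y"] by (intro bexI[of _ \<phi>]) linarith+
qed

section \<open>Weak* compactness of the quasi-states\<close>

lemma compactin_state_space: "compactin state_space K \<longleftrightarrow> compact K \<and> K \<subseteq> states"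
  by (simp add: state_space_def compactin_subtopology euclidean_product_topology)

lemma continuous_on_evaluation [continuous_intros]: "continuous_on S (\<lambda>\<phi>::'a \<Rightarrow> complex. \<phi> x)"
  by (rule continuous_on_subset[OF continuous_on_product_coordinates subset_UNIV])

lemma closed_quasi_states: "closed (quasi_states :: ('a::cstar_algebra \<Rightarrow> complex) set)"
proof -
  have "quasi_states = (\<Inter>x y. {\<phi>::'a \<Rightarrow> complex. \<phi> (x + y) = \<phi> x + \<phi> y}) \<inter>
     (\<Inter>c x. {\<phi>. \<phi> (c *\<^sub>C x) = c * \<phi> x}) \<inter> (\<Inter>x. {\<phi>. 0 \<le> Re (\<phi> (star x * x))}) \<inter>
     (\<Inter>x. {\<phi>. 0 = Im (\<phi> (star x * x))}) \<inter> (\<Inter>x. {\<phi>. cmod (\<phi> x) \<le> norm x})"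
    by (auto simp: quasi_states_def positive_functional_def less_eq_complex_def)
  also have "closed \<dots>"
    by (intro closed_Int closed_INT ballI closed_Collect_eq closed_Collect_le continuous_intros)
  finally show ?thesis .
qed

lemma compact_quasi_states: "compact (quasi_states :: ('a::cstar_algebra \<Rightarrow> complex) set)"
proof -
  have "compactin (product_topology (\<lambda>_. euclidean) UNIV) (PiE UNIV (\<lambda>x::'a. cball (0::complex) (norm x)))"
    by (simp add: compactin_PiE)
  then have "compact (PiE UNIV (\<lambda>x::'a. cball (0::complex) (norm x)))"
    by (simp add: euclidean_product_topology)
  then have "compact (PiE UNIV (\<lambda>x::'a. cball (0::complex) (norm x)) \<inter> quasi_states)"
    by (rule compact_Int_closed[OF _ closed_quasi_states])
  also have "PiE UNIV (\<lambda>x::'a. cball (0::complex) (norm x)) \<inter> quasi_states = quasi_states"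
    by (auto simp: quasi_states_def PiE_def)
  finally show ?thesis .
qed

text \<open>
  The weak* topology is the topology of pointwise convergence, and the quasi-states are closed
  in it.
\<close>

lemma quasi_state_pointwise_limit:
  fixes f :: "nat \<Rightarrow> 'a::cstar_algebra \<Rightarrow> complex"
  assumes "\<And>n. f n \<in> quasi_states" "\<And>a. (\<lambda>n. f n a) \<longlonglongrightarrow> g a"
  shows "g \<in> quasi_states"
proof -
  have "limitin (product_topology (\<lambda>_. euclidean) UNIV) f g sequentially"
    using assms by (simp add: limitin_componentwise)
  then have "f \<longlonglongrightarrow> g" by (simp add: euclidean_product_topology)
  then show ?thesis
    using assms(1) by (intro Lim_in_closed_set[OF closed_quasi_states]) auto
qed

section \<open>States and the approximate unit of a strictly positive element\<close>

lemma normalized_state: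
  fixes \<psi> :: "'a::cstar_algebra \<Rightarrow> complex"
  assumes \<psi>: "\<psi> \<in> quasi_states" and nz: "\<psi> a \<noteq> 0"
  shows "(\<lambda>b. \<psi> b / of_real (onorm \<psi>)) \<in> states"
proof -
  note bl = quasi_state_bounded_linear[OF \<psi>]
  have pos: "positive_functional \<psi>" using \<psi> by (simp add: quasi_states_def)
  have N: "onorm \<psi> > 0" using onorm_pos_lt[OF bl] nz by blast
  have eq: "(\<lambda>b. \<psi> b / of_real (onorm \<psi>)) = (\<lambda>b. (1 / onorm \<psi>) *\<^sub>R \<psi> b)"
    by (simp add: scaleR_conv_of_real)
  have "bounded_linear (\<lambda>b. \<psi> b / of_real (onorm \<psi>))"
    unfolding eq by (intro bounded_linear_const_scaleR bl)
  moreover have "onorm (\<lambda>b. \<psi> b / of_real (onorm \<psi>)) = 1"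
    unfolding eq onorm_scaleR[OF bl] using N by simp
  ultimately show ?thesis
    using positive_functional_Re[OF pos] positive_functional_Im[OF pos] N
    by (simp add: states_def positive_functional_linear[OF pos] less_eq_complex_def)
qed

lemma nonneg_square_mono:
  assumes D: "nonneg D" and n: "norm D \<le> 1"
  shows "nonneg (D - D * D)"
proof -
  have "nonneg (D * (1 - D))"
    using nonneg_scalar_minus[OF nonneg_selfadjoint[OF D] n]
    by (intro nonneg_mult_commuting D) (simp_all add: algebra_simps)
  then show ?thesis by (simp add: algebra_simps)
qed

text \<open>
  Cauchy-Schwarz, together with \<open>D\<^sup>2 \<le> D\<close>: a nonnegative contraction with a small value is
  negligible as a factor on either side.
\<close>

lemma positive_functional_small_factor:
  fixes F :: "'a::unital_cstar_algebra \<Rightarrow> complex"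
  assumes F: "positive_functional F" and F1: "F 1 = 1" and D: "nonneg D" "norm D \<le> 1"
  shows "cmod (F (D * y)) \<le> sqrt (Re (F D)) * norm y" "cmod (F (y * D)) \<le> sqrt (Re (F D)) * norm y"
proof -
  have sD: "star D = D" by (rule nonneg_selfadjoint[OF D(1)])
  have D0: "0 \<le> Re (F D)" using positive_functional_nonneg[OF F D(1)] by (simp add: less_eq_complex_def)
  have DD: "Re (F (D * D)) \<le> Re (F D)"
    by (rule positive_functional_mono[OF F nonneg_square_mono[OF D]])
  have yy: "Re (F (star y * y)) \<le> (norm y)\<^sup>2" for y
    using positive_functional_sandwich_le[OF F, of 1 y] by (simp add: F1)
  show 1: "cmod (F (D * y)) \<le> sqrt (Re (F D)) * norm y" for y
  proof (rule power2_le_imp_le)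
    have "(cmod (F (D * y)))\<^sup>2 \<le> Re (F (D * D)) * Re (F (star y * y))"
      using positive_functional_Cauchy_Schwarz[OF F, of D y] by (simp add: sD)
    also have "\<dots> \<le> Re (F D) * (norm y)\<^sup>2"
      by (intro mult_mono DD yy D0 positive_functional_Re[OF F])
    finally show "(cmod (F (D * y)))\<^sup>2 \<le> (sqrt (Re (F D)) * norm y)\<^sup>2"
      using D0 by (simp add: power_mult_distrib)
  qed (simp add: D0)
  have "F (y * D) = cnj (F (D * star y))"
    using positive_functional_star[OF F, of "D * star y"] by (simp add: star_simps sD)
  then show "cmod (F (y * D)) \<le> sqrt (Re (F D)) * norm y" using 1[of "star y"] by simp
qed

text \<open>
  The difference between \<open>1\<close> and an approximate unit that is built from \<open>h\<close>. The factor brings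
  \<open>h\<close> into the unit ball; the summand \<open>1\<close> in the denominator avoids a case distinction for
  \<open>h = 0\<close>.
\<close>

definition unit_defect :: "'a::cstar_algebra \<Rightarrow> nat \<Rightarrow> 'a unitization" where
  "unit_defect h n = (1 - unitize ((1 / (1 + norm h)) *\<^sub>R h)) ^ n"

context
  fixes h :: "'a::cstar_algebra"
  assumes h: "positive_element h"
begin

lemma nonneg_unitize_positive:
  "nonneg (unitize ((1 / (1 + norm h)) *\<^sub>R h))" "norm (unitize ((1 / (1 + norm h)) *\<^sub>R h)) \<le> 1"
proof -
  have pos: "1 + norm h > 0" by (simp add: add_pos_nonneg)
  obtain b where b: "h = star b * b" using h by (auto simp: positive_element_def)
  have "nonneg (unitize h)" unfolding b unitize_simps by (rule nonneg_star_mult_self)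
  then show "nonneg (unitize ((1 / (1 + norm h)) *\<^sub>R h))"
    unfolding unitize_simps by (rule nonneg_scaleR) (use pos in simp)
  show "norm (unitize ((1 / (1 + norm h)) *\<^sub>R h)) \<le> 1" using pos by (simp add: divide_simps)
qed

lemma nonneg_unit_defect: "nonneg (unit_defect h n)"
  and norm_unit_defect_le: "norm (unit_defect h n) \<le> 1"
  and nonneg_one_minus_unit_defect: "nonneg (1 - unit_defect h n)"
  and norm_one_minus_unit_defect_le: "norm (1 - unit_defect h n) \<le> 1"
  and nonneg_unit_defect_diff: "n \<le> m \<Longrightarrow> nonneg (unit_defect h n - unit_defect h m)"
  and norm_unit_defect_diff_le: "n \<le> m \<Longrightarrow> norm (unit_defect h n - unit_defect h m) \<le> 1"
  unfolding unit_defect_def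
  by (simp_all add: nonneg_one_minus_power norm_one_minus_power_le nonneg_approximate_unit
      norm_approximate_unit_le one_minus_power_diff nonneg_unitize_positive del: norm_unitize)

lemma norm_mult_unit_defect_le: "norm (unitize h * unit_defect h n) \<le> (1 + norm h) / real (Suc n)"
proof -
  have pos: "1 + norm h > 0" by (simp add: add_pos_nonneg)
  have "norm (unitize ((1 / (1 + norm h)) *\<^sub>R h) * unit_defect h n) \<le> 1 / real (Suc n)"
    unfolding unit_defect_def by (rule norm_mult_one_minus_power_le[OF nonneg_unitize_positive])
  then have "norm ((1 / (1 + norm h)) *\<^sub>R (unitize h * unit_defect h n)) \<le> 1 / real (Suc n)"
    by (simp add: unitize_simps)
  then have "norm (unitize h * unit_defect h n) / (1 + norm h) \<le> 1 / real (Suc n)"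
    using pos by (simp del: of_nat_Suc)
  then show ?thesis using pos by (simp add: pos_divide_le_eq del: of_nat_Suc)
qed

text \<open>
  With \<open>x = c h\<close>, the geometric sum gives \<open>1 - (1 - x)\<^sup>n = x f = f x\<close> where \<open>f\<close> is a sum of \<open>n\<close>
  contractions.
\<close>

lemma norm_unit_sandwich_le:
  "norm ((1 - unit_defect h n) * unitize a * (1 - unit_defect h n)) \<le> (real n)\<^sup>2 * norm (h * a * h)"
proof -
  define c where "c = 1 / (1 + norm h)"
  have c: "0 \<le> c" "c \<le> 1" by (simp_all add: c_def add_pos_nonneg)
  define x where "x = unitize (c *\<^sub>R h)"
  define f where "f = (\<Sum>k<n. (1 - x) ^ k)"
  have x: "nonneg x" "norm x \<le> 1" using nonneg_unitize_positive by (simp_all only: x_def c_def)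
  have nf: "norm f \<le> real n"
    unfolding f_def using sum_norm_le[of "{..<n}" "\<lambda>k. (1 - x) ^ k" "\<lambda>_. 1"] norm_one_minus_power_le[OF x]
    by simp
  have xf: "x * f = f * x"
    unfolding f_def sum_distrib_left sum_distrib_right
    by (intro sum.cong refl power_commuting_commutes[symmetric]) (simp add: algebra_simps)
  have u: "1 - unit_defect h n = x * f"
    using one_minus_mult_geometric_sum[of x n]
    by (simp add: unit_defect_def f_def sum_distrib_left x_def c_def)
  have "(1 - unit_defect h n) * unitize a * (1 - unit_defect h n) = (f * x) * unitize a * (x * f)"
    unfolding u by (simp only: xf)
  also have "\<dots> = f * (c\<^sup>2 *\<^sub>R unitize (h * a * h)) * f"
    by (simp add: x_def unitize_simps mult.assoc power2_eq_square)
  finally have "norm ((1 - unit_defect h n) * unitize a * (1 - unit_defect h n))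
      = norm (f * (c\<^sup>2 *\<^sub>R unitize (h * a * h)) * f)" by simp
  also have "\<dots> \<le> norm f * norm (c\<^sup>2 *\<^sub>R unitize (h * a * h)) * norm f"
    by (intro norm_mult_ineq[THEN order_trans] mult_right_mono norm_mult_ineq) simp_all
  also have "\<dots> \<le> real n * (1 * norm (h * a * h)) * real n"
    using c nf by (intro mult_mono) (simp_all add: power_le_one mult_left_le_one_le)
  finally show ?thesis by (simp add: power2_eq_square mult_ac)
qed

text \<open>
  The difference of \<open>a\<close> and \<open>(1 - v) a (1 - v)\<close> is \<open>v a + (1 - v) a v\<close>, whose terms have \<open>v\<close>
  as a factor.
\<close>

lemma quasi_state_le_unit_sandwich:
  assumes \<phi>: "\<phi> \<in> quasi_states"
  shows "cmod (\<phi> a) \<le> (real n)\<^sup>2 * norm (h * a * h) + 2 * sqrt (Re (unital_extension \<phi> (unit_defect h n))) * norm a"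
proof -
  note F = positive_unital_extension[OF \<phi>]
  let ?F = "unital_extension \<phi>" and ?v = "unit_defect h n"
  let ?s = "sqrt (Re (?F ?v))"
  have "unitize a = (1 - ?v) * unitize a * (1 - ?v) + (?v * unitize a + ((1 - ?v) * unitize a) * ?v)"
    by (simp add: algebra_simps)
  then have "\<phi> a = ?F ((1 - ?v) * unitize a * (1 - ?v)) + (?F (?v * unitize a) + ?F (((1 - ?v) * unitize a) * ?v))"
    by (metis positive_functional_add[OF F(1)] unital_extension_unitize)
  then have "cmod (\<phi> a) \<le> cmod (?F ((1 - ?v) * unitize a * (1 - ?v))) +
      (cmod (?F (?v * unitize a)) + cmod (?F (((1 - ?v) * unitize a) * ?v)))"
    by (simp only:) (intro norm_triangle_mono norm_triangle_ineq order_refl)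
  moreover have "cmod (?F ((1 - ?v) * unitize a * (1 - ?v))) \<le> (real n)\<^sup>2 * norm (h * a * h)"
    using positive_functional_norm_le[OF F(1), of "(1 - ?v) * unitize a * (1 - ?v)"] norm_unit_sandwich_le[of n a]
    by (simp add: F(2))
  moreover have "cmod (?F (?v * unitize a)) \<le> ?s * norm a"
    using positive_functional_small_factor(1)[OF F nonneg_unit_defect norm_unit_defect_le, of n "unitize a"] by simp
  moreover have "cmod (?F (((1 - ?v) * unitize a) * ?v)) \<le> ?s * norm ((1 - ?v) * unitize a)"
    by (rule positive_functional_small_factor(2)[OF F nonneg_unit_defect norm_unit_defect_le])
  moreover have "?s * norm ((1 - ?v) * unitize a) \<le> ?s * norm a"
  proof (rule mult_left_mono)
    have "norm ((1 - ?v) * unitize a) \<le> norm (1 - ?v) * norm (unitize a)" by (rule norm_mult_ineq)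
    also have "\<dots> \<le> norm a" using norm_one_minus_unit_defect_le by (simp add: mult_left_le_one_le)
    finally show "norm ((1 - ?v) * unitize a) \<le> norm a" .
    show "0 \<le> ?s" using positive_functional_nonneg[OF F(1) nonneg_unit_defect] by (simp add: less_eq_complex_def)
  qed
  ultimately show ?thesis by simp
qed

lemma unit_defect_decreasing:
  assumes \<phi>: "\<phi> \<in> quasi_states" and nm: "n \<le> m"
  shows "Re (unital_extension \<phi> (unit_defect h m)) \<le> Re (unital_extension \<phi> (unit_defect h n))"
  by (rule positive_functional_mono[OF positive_unital_extension(1)[OF \<phi>] nonneg_unit_defect_diff[OF nm]])

lemma unit_defect_bounds:
  assumes \<phi>: "\<phi> \<in> quasi_states"
  shows "0 \<le> Re (unital_extension \<phi> (unit_defect h n))"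
  using positive_functional_nonneg[OF positive_unital_extension(1)[OF \<phi>] nonneg_unit_defect]
  by (simp add: less_eq_complex_def)

lemma compressed_quasi_state:
  assumes \<phi>: "\<phi> \<in> quasi_states"
  shows "(\<lambda>a. unital_extension \<phi> (unit_defect h n * unitize a * unit_defect h n)) \<in> quasi_states"
proof -
  note F = positive_unital_extension[OF \<phi>]
  let ?F = "unital_extension \<phi>" and ?v = "unit_defect h n"
  have sv: "star ?v = ?v" by (rule nonneg_selfadjoint[OF nonneg_unit_defect])
  have "0 \<le> ?F (?v * unitize (star x * x) * ?v)" for x
  proof -
    have "?v * unitize (star x * x) * ?v = star (unitize x * ?v) * (unitize x * ?v)"
      by (simp add: star_mult sv unitize_simps mult.assoc)
    then show ?thesis using F(1) by (simp add: positive_functional_def)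
  qed
  moreover have "cmod (?F (?v * unitize a * ?v)) \<le> norm a" for a
  proof -
    have "cmod (?F (?v * unitize a * ?v)) \<le> norm (?v * unitize a * ?v)"
      using positive_functional_norm_le[OF F(1), of "?v * unitize a * ?v"] by (simp add: F(2))
    also have "\<dots> \<le> norm ?v * norm (unitize a) * norm ?v"
      by (intro norm_mult_ineq[THEN order_trans] mult_right_mono norm_mult_ineq) simp_all
    also have "\<dots> \<le> 1 * norm (unitize a) * 1"
      by (intro mult_mono norm_unit_defect_le) simp_all
    finally show ?thesis by simp
  qed
  ultimately show ?thesis
    by (simp add: quasi_states_def positive_functional_def unitize_simps algebra_simps
        mult_scaleC_left mult_scaleC_right positive_functional_linear[OF F(1)])
qed

text \<open>
  The values \<open>d n\<close> of \<open>\<phi>\<close> at the defects decrease to some \<open>l\<close>. This makes the values of the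
  compressions of \<open>\<phi>\<close> by the defects Cauchy sequences; their limit \<open>\<psi>\<close> vanishes at \<open>h\<close>, so it
  is zero, because otherwise a multiple of it would be a state vanishing at \<open>h\<close>. In terms of
  the GNS construction, the limit of the defects applied to the cyclic vector is orthogonal to
  the whole space. Concretely, \<open>\<phi>(a)\<close> is the limit of the extended functional at \<open>a (1 - v\<^sub>n)\<close>,
  which is at most \<open>\<parallel>a\<parallel> sqrt (1 - d n)\<close>, and \<open>\<phi>\<close> having norm \<open>1\<close> leaves only \<open>l = 0\<close>.
\<close>

lemma unit_defect_tendsto_zero:
  assumes sp: "strictly_positive h" and state: "\<phi> \<in> states"
  shows "(\<lambda>n. Re (unital_extension \<phi> (unit_defect h n))) \<longlonglongrightarrow> 0"
proof -
  have \<phi>: "\<phi> \<in> quasi_states" by (rule state_imp_quasi_state[OF state])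
  note F = positive_unital_extension[OF \<phi>]
  let ?F = "unital_extension \<phi>" and ?v = "unit_defect h"
  define d where "d n = Re (?F (?v n))" for n
  have "decseq d" unfolding d_def by (intro decseq_SucI unit_defect_decreasing[OF \<phi>]) simp
  moreover have d0: "0 \<le> d n" for n unfolding d_def by (rule unit_defect_bounds[OF \<phi>])
  ultimately obtain l where l: "d \<longlonglongrightarrow> l"
    using decseq_convergent[of d 0] by blast
  have l0: "0 \<le> l" using l d0 by (intro LIMSEQ_le_const) auto
  have step: "cmod (?F (?v n * unitize a * ?v n) - ?F (?v m * unitize a * ?v m)) \<le> 2 * sqrt (d n - d m) * norm a"
    if nm: "n \<le> m" for n m a
  proof -
    let ?D = "?v n - ?v m"
    have eq: "?v n * unitize a * ?v n - ?v m * unitize a * ?v m = ?D * (unitize a * ?v n) + (?v m * unitize a) * ?D"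
      by (simp add: algebra_simps)
    have FD: "Re (?F ?D) = d n - d m" by (simp add: d_def positive_functional_linear[OF F(1)])
    have s: "0 \<le> sqrt (d n - d m)"
      using positive_functional_nonneg[OF F(1) nonneg_unit_defect_diff[OF nm]] by (simp add: less_eq_complex_def FD)
    have "cmod (?F (?D * (unitize a * ?v n))) \<le> sqrt (d n - d m) * norm (unitize a * ?v n)"
      using positive_functional_small_factor(1)[OF F nonneg_unit_defect_diff[OF nm] norm_unit_defect_diff_le[OF nm]]
      unfolding FD .
    also have "norm (unitize a * ?v n) \<le> norm a"
      using norm_mult_ineq[of "unitize a" "?v n"] norm_unit_defect_le[of n] by (simp add: mult_left_le order_trans)
    finally have 1: "cmod (?F (?D * (unitize a * ?v n))) \<le> sqrt (d n - d m) * norm a"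
      using s by (simp add: mult_left_mono)
    have "cmod (?F ((?v m * unitize a) * ?D)) \<le> sqrt (d n - d m) * norm (?v m * unitize a)"
      using positive_functional_small_factor(2)[OF F nonneg_unit_defect_diff[OF nm] norm_unit_defect_diff_le[OF nm]]
      unfolding FD .
    also have "norm (?v m * unitize a) \<le> norm a"
      using norm_mult_ineq[of "?v m" "unitize a"] norm_unit_defect_le[of m] by (simp add: mult_left_le_one_le order_trans)
    finally have 2: "cmod (?F ((?v m * unitize a) * ?D)) \<le> sqrt (d n - d m) * norm a"
      using s by (simp add: mult_left_mono)
    have "?F (?v n * unitize a * ?v n) - ?F (?v m * unitize a * ?v m) = ?F (?D * (unitize a * ?v n)) + ?F ((?v m * unitize a) * ?D)"
      by (simp only: positive_functional_diff[OF F(1), symmetric] eq positive_functional_add[OF F(1), symmetric])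
    then show ?thesis
      using norm_triangle_ineq[of "?F (?D * (unitize a * ?v n))" "?F ((?v m * unitize a) * ?D)"] 1 2 by simp
  qed
  have "Cauchy (\<lambda>n. ?F (?v n * unitize a * ?v n))" for a
  proof (rule CauchyI')
    fix e :: real assume e: "e > 0"
    \<comment> \<open>Chosen so that \<open>2 sqrt \<eta> \<parallel>a\<parallel> < e\<close>, the summand \<open>1\<close> covering the case \<open>a = 0\<close>.\<close>
    define \<eta> where "\<eta> = (e / (2 * (norm a + 1)))\<^sup>2"
    have na: "norm a + 1 > 0" by (simp add: add_nonneg_pos)
    have "\<eta> > 0" using e na by (simp add: \<eta>_def)
    then obtain M where M: "\<And>n. n \<ge> M \<Longrightarrow> \<bar>d n - l\<bar> < \<eta>"
      using LIMSEQ_D[OF l] by auto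
    have "l \<le> d m" for m using decseq_ge[OF \<open>decseq d\<close> l] .
    have "cmod (?F (?v m * unitize a * ?v m) - ?F (?v n * unitize a * ?v n)) < e" if "m \<ge> M" "n > m" for m n
    proof -
      have "d m - d n \<le> \<eta>" using M[of m] that \<open>l \<le> d n\<close> by simp
      then have "sqrt (d m - d n) \<le> e / (2 * (norm a + 1))"
        using e na by (intro real_le_lsqrt) (simp_all add: \<eta>_def)
      then have "2 * sqrt (d m - d n) * norm a \<le> 2 * (e / (2 * (norm a + 1))) * norm a"
        by (intro mult_right_mono mult_left_mono) simp_all
      also have "\<dots> < e" using e na by (simp add: field_simps)
      finally show ?thesis using step[of m n a] that by simp
    qed
    then show "\<exists>M. \<forall>m\<ge>M. \<forall>n>m. dist (?F (?v m * unitize a * ?v m)) (?F (?v n * unitize a * ?v n)) < e"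
      unfolding dist_norm by blast
  qed
  then have "\<forall>a. \<exists>z. (\<lambda>n. ?F (?v n * unitize a * ?v n)) \<longlonglongrightarrow> z"
    by (metis Cauchy_convergent convergent_def)
  then obtain \<psi> where \<psi>: "\<And>a. (\<lambda>n. ?F (?v n * unitize a * ?v n)) \<longlonglongrightarrow> \<psi> a" by metis
  have \<psi>Q: "\<psi> \<in> quasi_states"
    by (rule quasi_state_pointwise_limit[OF compressed_quasi_state[OF \<phi>] \<psi>])
  have "\<psi> h = 0"
  proof -
    have "cmod (?F (?v n * unitize h * ?v n)) \<le> (1 + norm h) * (1 / real (Suc n))" for n
    proof -
      have "cmod (?F (?v n * unitize h * ?v n)) \<le> norm (?v n * (unitize h * ?v n))"
        using positive_functional_norm_le[OF F(1)] by (simp add: F(2) mult.assoc)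
      also have "\<dots> \<le> norm (?v n) * norm (unitize h * ?v n)" by (rule norm_mult_ineq)
      also have "\<dots> \<le> 1 * norm (unitize h * ?v n)" by (intro mult_right_mono norm_unit_defect_le) simp
      also have "\<dots> \<le> (1 + norm h) * (1 / real (Suc n))" using norm_mult_unit_defect_le[of n] by simp
      finally show ?thesis .
    qed
    moreover have "(\<lambda>n. (1 + norm h) * (1 / real (Suc n))) \<longlonglongrightarrow> 0"
      using tendsto_mult_right_zero[OF LIMSEQ_inverse_real_of_nat] by (simp add: inverse_eq_divide)
    ultimately have "(\<lambda>n. ?F (?v n * unitize h * ?v n)) \<longlonglongrightarrow> 0"
      by (rule Lim_null_comparison[OF always_eventually[OF allI]])
    with \<psi>[of h] show ?thesis using LIMSEQ_unique by blast
  qed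
  have \<psi>0: "\<psi> a = 0" for a
  proof (rule ccontr)
    assume "\<psi> a \<noteq> 0"
    from normalized_state[OF \<psi>Q this] sp
    have "0 < \<psi> h / of_real (onorm \<psi>)" by (auto simp: strictly_positive_def)
    then show False using \<open>\<psi> h = 0\<close> by simp
  qed
  have bound: "cmod (\<phi> a) \<le> norm a * sqrt (1 - l)" for a
  proof -
    have sv: "star (?v n) = ?v n" for n by (rule nonneg_selfadjoint[OF nonneg_unit_defect])
    have "(cmod (?F (unitize a * ?v n)))\<^sup>2 \<le> cmod (?F (?v n * unitize (star a * a) * ?v n))" for n
    proof -
      have "(cmod (?F (unitize a * ?v n)))\<^sup>2 \<le> Re (?F (star (unitize a * ?v n) * (unitize a * ?v n)))"
        using positive_functional_Cauchy_Schwarz[OF F(1), of 1 "unitize a * ?v n"] by (simp add: F(2))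
      also have "star (unitize a * ?v n) * (unitize a * ?v n) = ?v n * unitize (star a * a) * ?v n"
        by (simp add: star_mult sv unitize_simps mult.assoc)
      finally show ?thesis using complex_Re_le_cmod order_trans by blast
    qed
    then have le: "cmod (?F (unitize a * ?v n)) \<le> sqrt (cmod (?F (?v n * unitize (star a * a) * ?v n)))" for n
      by (simp add: real_le_rsqrt)
    have "(\<lambda>n. sqrt (cmod (?F (?v n * unitize (star a * a) * ?v n)))) \<longlonglongrightarrow> sqrt (cmod 0)"
      using \<psi>[of "star a * a"] unfolding \<psi>0 by (intro tendsto_intros)
    then have "(\<lambda>n. sqrt (cmod (?F (?v n * unitize (star a * a) * ?v n)))) \<longlonglongrightarrow> 0" by simp
    then have "(\<lambda>n. ?F (unitize a * ?v n)) \<longlonglongrightarrow> 0"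
      by (rule Lim_null_comparison[OF always_eventually[OF allI[OF le]]])
    then have "(\<lambda>n. \<phi> a - ?F (unitize a * ?v n)) \<longlonglongrightarrow> \<phi> a - 0"
      by (rule tendsto_diff[OF tendsto_const])
    then have "(\<lambda>n. cmod (\<phi> a - ?F (unitize a * ?v n))) \<longlonglongrightarrow> cmod (\<phi> a - 0)"
      by (rule tendsto_norm)
    moreover have "cmod (\<phi> a - ?F (unitize a * ?v n)) \<le> norm a * sqrt (1 - d n)" for n
    proof -
      have "\<phi> a - ?F (unitize a * ?v n) = ?F (unitize a * (1 - ?v n))"
        by (simp add: right_diff_distrib positive_functional_diff[OF F(1)])
      then show ?thesis
        using positive_functional_small_factor(2)[OF F nonneg_one_minus_unit_defect norm_one_minus_unit_defect_le, of "unitize a" n]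
        by (simp add: positive_functional_diff[OF F(1)] F(2) d_def mult.commute)
    qed
    moreover have "(\<lambda>n. norm a * sqrt (1 - d n)) \<longlonglongrightarrow> norm a * sqrt (1 - l)"
      by (intro tendsto_intros l)
    ultimately show ?thesis by (simp add: LIMSEQ_le)
  qed
  have "onorm \<phi> = 1" using state by (simp add: states_def)
  moreover have "l \<le> 1"
  proof -
    have "d 0 = 1" by (simp add: d_def unit_defect_def F(2))
    then show ?thesis using decseq_ge[OF \<open>decseq d\<close> l, of 0] by simp
  qed
  then have "onorm \<phi> \<le> sqrt (1 - l)"
    by (intro onorm_bound) (simp_all add: bound mult.commute)
  ultimately have "l = 0" using l0 by simp
  with l show ?thesis by (simp add: d_def[abs_def])
qed

text \<open>
  Dini's argument: the sets where the \<open>n\<close>-th value is below \<open>e\<close> are open, increase with \<open>n\<close> on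
  quasi-states, and cover \<open>K\<close>.
\<close>

lemma unit_defect_uniformly_small:
  assumes sp: "strictly_positive h" and K: "compact K" "K \<subseteq> states" and e: "e > 0"
  obtains n where "\<And>\<phi>. \<phi> \<in> K \<Longrightarrow> Re (unital_extension \<phi> (unit_defect h n)) < e"
proof -
  let ?U = "\<lambda>n. {\<phi>. Re (unital_extension \<phi> (unit_defect h n)) < e}"
  have "open (?U n)" for n
    unfolding unital_extension_def by (intro open_Collect_less continuous_intros)
  moreover have "K \<subseteq> (\<Union>n. ?U n)"
  proof
    fix \<phi> assume "\<phi> \<in> K"
    with K have "\<phi> \<in> states" by blast
    from order_tendstoD(2)[OF unit_defect_tendsto_zero[OF sp this] e]
    show "\<phi> \<in> (\<Union>n. ?U n)" by (auto simp: eventually_sequentially)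
  qed
  ultimately obtain C where C: "finite C" "K \<subseteq> (\<Union>n\<in>C. ?U n)"
    using compactE_image[OF K(1), of UNIV ?U] by auto
  have "Re (unital_extension \<phi> (unit_defect h (Max C))) < e" if \<phi>: "\<phi> \<in> K" for \<phi>
  proof -
    obtain n where n: "n \<in> C" "Re (unital_extension \<phi> (unit_defect h n)) < e" using C \<phi> by blast
    have "n \<le> Max C" using C n by simp
    from unit_defect_decreasing[OF state_imp_quasi_state this] n \<phi> K show ?thesis by fastforce
  qed
  then show thesis using that by blast
qed

end

section \<open>The seminorms of the weakly-uniform topology\<close>

lemma state_norm_le: "\<phi> \<in> states \<Longrightarrow> cmod (\<phi> a) \<le> norm a"
  using state_imp_quasi_state by (auto simp: quasi_states_def)

lemma sup_seminorm_least:
  assumes "\<And>\<phi>. \<phi> \<in> K \<Longrightarrow> cmod (\<phi> a) \<le> r" "0 \<le> r"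
  shows "sup_seminorm K a \<le> r"
  using assms by (auto simp: sup_seminorm_def intro: cSUP_least)

context
  fixes K :: "('a::cstar_algebra \<Rightarrow> complex) set"
  assumes K: "K \<subseteq> states"
begin

lemma sup_seminorm_upper:
  assumes "\<phi> \<in> K"
  shows "cmod (\<phi> a) \<le> sup_seminorm K a"
proof -
  have "bdd_above ((\<lambda>\<phi>. cmod (\<phi> a)) ` K)"
    using K state_norm_le by (auto intro!: bdd_aboveI2)
  with assms show ?thesis by (auto simp: sup_seminorm_def intro: cSUP_upper)
qed

lemma sup_seminorm_nonneg: "0 \<le> sup_seminorm K a"
proof (cases "K = {}")
  case False
  then obtain \<phi> where "\<phi> \<in> K" by blast
  then show ?thesis using sup_seminorm_upper[of \<phi> a] norm_ge_zero order_trans by blast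
qed (simp add: sup_seminorm_def)

lemma sup_seminorm_triangle: "sup_seminorm K (a + b) \<le> sup_seminorm K a + sup_seminorm K b"
proof (rule sup_seminorm_least)
  fix \<phi> assume \<phi>: "\<phi> \<in> K"
  then have eq: "\<phi> (a + b) = \<phi> a + \<phi> b"
    using K state_imp_quasi_state positive_functional_add by (fastforce simp: quasi_states_def)
  then show "cmod (\<phi> (a + b)) \<le> sup_seminorm K a + sup_seminorm K b"
    unfolding eq using norm_triangle_ineq[of "\<phi> a" "\<phi> b"] sup_seminorm_upper[OF \<phi>, of a] sup_seminorm_upper[OF \<phi>, of b]
    by linarith
qed (simp add: sup_seminorm_nonneg)

lemma sup_seminorm_zero: "sup_seminorm K 0 = 0"
proof (rule antisym)
  show "sup_seminorm K 0 \<le> 0"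
    using K state_norm_le[of _ 0] by (intro sup_seminorm_least) auto
qed (rule sup_seminorm_nonneg)

lemma sup_seminorm_mono: "L \<subseteq> K \<Longrightarrow> sup_seminorm L a \<le> sup_seminorm K a"
  using sup_seminorm_upper sup_seminorm_nonneg by (intro sup_seminorm_least) auto

end

lemma openin_wu_ball:
  "compactin state_space K \<Longrightarrow> e > 0 \<Longrightarrow> openin wu_topology {y. sup_seminorm K (y - x) < e}"
  unfolding wu_topology_def seminorm_topology_def by (rule topology_generated_by_Basis) blast

text \<open>
  The balls of the seminorms form a base and not only a subbase, because the union of two
  compact sets of states is compact and its seminorm dominates both.
\<close>

lemma openin_wu_topology_iff:
  fixes U :: "'a::cstar_algebra set"
  shows "openin wu_topology U \<longleftrightarrow>
    (\<forall>x\<in>U. \<exists>K e. compactin state_space K \<and> e > 0 \<and> {y. sup_seminorm K (y - x) < e} \<subseteq> U)"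
    (is "_ \<longleftrightarrow> (\<forall>x\<in>U. ?P U x)")
proof
  assume "openin wu_topology U"
  then have "generate_topology_on (insert UNIV {{y::'a. p (y - x) < e} | p x e.
      p \<in> {sup_seminorm K | K. compactin state_space K} \<and> 0 < e}) U"
    by (simp add: wu_topology_def seminorm_topology_def openin_topology_generated_by_iff)
  then show "\<forall>x\<in>U. ?P U x"
  proof induction
    case (Int U V)
    show ?case
    proof
      fix x assume "x \<in> U \<inter> V"
      with Int.IH obtain K e L f where K: "compactin state_space K" "e > 0" "{y. sup_seminorm K (y - x) < e} \<subseteq> U"
        and L: "compactin state_space L" "f > 0" "{y. sup_seminorm L (y - x) < f} \<subseteq> V" by blast
      have KL: "compactin state_space (K \<union> L)" using K L by (intro compactin_Un)
      then have "K \<union> L \<subseteq> states" by (simp add: compactin_state_space)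
      then have le: "sup_seminorm K z \<le> sup_seminorm (K \<union> L) z" "sup_seminorm L z \<le> sup_seminorm (K \<union> L) z" for z
        by (simp_all add: sup_seminorm_mono)
      have "{y. sup_seminorm (K \<union> L) (y - x) < min e f} \<subseteq> U \<inter> V"
      proof
        fix y assume "y \<in> {y. sup_seminorm (K \<union> L) (y - x) < min e f}"
        then have "sup_seminorm K (y - x) < e" "sup_seminorm L (y - x) < f"
          using le[of "y - x"] by auto
        then show "y \<in> U \<inter> V" using K(3) L(3) by blast
      qed
      with KL K(2) L(2) show "?P (U \<inter> V) x" by (intro exI[of _ "K \<union> L"] exI[of _ "min e f"]) simp
    qed
  next
    case (UN \<U>)
    show ?case
    proof
      fix x assume "x \<in> \<Union>\<U>"
      then obtain V where V: "V \<in> \<U>" "x \<in> V" by blast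
      from UN.IH[OF V(1)] V(2) obtain K e where
        "compactin state_space K" "e > 0" "{y. sup_seminorm K (y - x) < e} \<subseteq> V" by blast
      with V(1) show "?P (\<Union>\<U>) x" by blast
    qed
  next
    case (Basis S)
    then consider "S = UNIV" | K x e where "S = {y. sup_seminorm K (y - x) < e}" "compactin state_space K" "e > 0"
      by blast
    then show ?case
    proof cases
      case 1
      have "compactin state_space {}" by simp
      with 1 show ?thesis by (metis subset_UNIV zero_less_one)
    next
      case 2
      show ?thesis
      proof
        fix z assume z: "z \<in> S"
        have K: "K \<subseteq> states" using 2 by (simp add: compactin_state_space)
        have "sup_seminorm K (y - x) \<le> sup_seminorm K (y - z) + sup_seminorm K (z - x)" for y
          using sup_seminorm_triangle[OF K, of "y - z" "z - x"] by simp
        then have "{y. sup_seminorm K (y - z) < e - sup_seminorm K (z - x)} \<subseteq> S"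
          unfolding 2(1) by (auto simp: less_diff_eq intro: le_less_trans)
        then show "?P S z" using 2 z by (intro exI[of _ K] exI[of _ "e - sup_seminorm K (z - x)"]) simp
      qed
    qed
  qed simp
next
  assume *: "\<forall>x\<in>U. ?P U x"
  show "openin wu_topology U"
  proof (subst openin_subopen, intro ballI)
    fix x assume "x \<in> U"
    with * obtain K e where K: "compactin state_space K" "e > 0" "{y. sup_seminorm K (y - x) < e} \<subseteq> U" by blast
    have "x \<in> {y. sup_seminorm K (y - x) < e}"
      using K by (simp add: sup_seminorm_zero compactin_state_space)
    with K openin_wu_ball[OF K(1,2)] show "\<exists>T. openin wu_topology T \<and> x \<in> T \<and> T \<subseteq> U" by blast
  qed
qed

lemma topspace_wu_topology [simp]: "topspace wu_topology = UNIV"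
proof -
  have "compactin state_space {}" by simp
  then have "openin wu_topology UNIV"
    unfolding openin_wu_topology_iff by (metis subset_UNIV zero_less_one)
  then show ?thesis using openin_subset by blast
qed

lemma limitin_wu_topology_zero_iff:
  fixes f :: "'i \<Rightarrow> 'a::cstar_algebra"
  shows "limitin wu_topology f 0 F \<longleftrightarrow>
    (\<forall>K e. compactin state_space K \<longrightarrow> e > 0 \<longrightarrow> eventually (\<lambda>i. sup_seminorm K (f i) < e) F)"
proof
  assume lim: "limitin wu_topology f 0 F"
  show "\<forall>K e. compactin state_space K \<longrightarrow> e > 0 \<longrightarrow> eventually (\<lambda>i. sup_seminorm K (f i) < e) F"
  proof (intro allI impI)
    fix K :: "('a \<Rightarrow> complex) set" and e :: real assume K: "compactin state_space K" "e > 0"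
    have "0 \<in> {y. sup_seminorm K (y - 0) < e}"
      using K by (simp add: sup_seminorm_zero compactin_state_space)
    with lim openin_wu_ball[OF K, of 0] have "eventually (\<lambda>i. f i \<in> {y. sup_seminorm K (y - 0) < e}) F"
      unfolding limitin_def by blast
    then show "eventually (\<lambda>i. sup_seminorm K (f i) < e) F" by simp
  qed
next
  assume *: "\<forall>K e. compactin state_space K \<longrightarrow> e > 0 \<longrightarrow> eventually (\<lambda>i. sup_seminorm K (f i) < e) F"
  show "limitin wu_topology f 0 F"
    unfolding limitin_def
  proof (intro conjI allI impI)
    fix U :: "'a set" assume "openin wu_topology U \<and> 0 \<in> U"
    then obtain K e where K: "compactin state_space K" "e > 0" "{y. sup_seminorm K (y - 0) < e} \<subseteq> U"
      unfolding openin_wu_topology_iff by blast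
    then have "eventually (\<lambda>i. sup_seminorm K (f i) < e) F" using * by blast
    then show "eventually (\<lambda>i. f i \<in> U) F" by (rule eventually_mono) (use K(3) in auto)
  qed simp
qed

section \<open>Comparison of the seminorms with the compressed norm\<close>

text \<open>
  First \<open>n\<close> is chosen such that the error terms in the estimate of \<open>\<phi>(a)\<close> are uniformly small
  on \<open>K\<close>, then \<open>\<delta>\<close> such that \<open>n\<^sup>2 \<parallel>h a h\<parallel>\<close> is small.
\<close>

lemma sup_seminorm_small_if_compression_small:
  fixes h :: "'a::cstar_algebra"
  assumes sp: "strictly_positive h" and K: "compactin state_space K" and e: "e > 0" and M: "M \<ge> 0"
  obtains \<delta> where "\<delta> > 0" "\<And>a. norm a \<le> M \<Longrightarrow> norm (h * a * h) < \<delta> \<Longrightarrow> sup_seminorm K a < e"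
proof -
  have h: "positive_element h" using sp by (simp add: strictly_positive_def)
  have Kc: "compact K" "K \<subseteq> states" using K by (simp_all add: compactin_state_space)
  define \<eta> where "\<eta> = (e / (8 * (M + 1)))\<^sup>2"
  have "\<eta> > 0" using e M by (simp add: \<eta>_def)
  then obtain n where n: "\<And>\<phi>. \<phi> \<in> K \<Longrightarrow> Re (unital_extension \<phi> (unit_defect h n)) < \<eta>"
    using unit_defect_uniformly_small[OF h sp Kc] by blast
  define \<delta> where "\<delta> = e / (4 * ((real n)\<^sup>2 + 1))"
  have n2: "(real n)\<^sup>2 + 1 > 0" by (simp add: add_nonneg_pos)
  have cancel: "N > 0 \<Longrightarrow> e / (4 * N) * N = e / 4" for N :: real by simp
  show thesis
  proof (rule that[of \<delta>])
    show "\<delta> > 0" using e n2 by (simp add: \<delta>_def)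
    fix a assume a: "norm a \<le> M" "norm (h * a * h) < \<delta>"
    have "sup_seminorm K a \<le> e / 2"
    proof (rule sup_seminorm_least)
      fix \<phi> assume \<phi>: "\<phi> \<in> K"
      then have Q: "\<phi> \<in> quasi_states" using Kc state_imp_quasi_state by blast
      have "sqrt (Re (unital_extension \<phi> (unit_defect h n))) \<le> e / (8 * (M + 1))"
        using n[OF \<phi>] e M by (intro real_le_lsqrt) (simp_all add: \<eta>_def)
      then have "2 * sqrt (Re (unital_extension \<phi> (unit_defect h n))) * norm a \<le> 2 * (e / (8 * (M + 1))) * M"
        using a e M unit_defect_bounds[OF h Q, of n] by (intro mult_mono) simp_all
      also have "\<dots> \<le> e / 4" using e M by (simp add: field_simps)
      finally have 1: "2 * sqrt (Re (unital_extension \<phi> (unit_defect h n))) * norm a \<le> e / 4" .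
      have "(real n)\<^sup>2 * norm (h * a * h) \<le> (real n)\<^sup>2 * \<delta>"
        using a by (intro mult_left_mono) simp_all
      also have "\<dots> \<le> ((real n)\<^sup>2 + 1) * \<delta>" using \<open>\<delta> > 0\<close> by (simp add: algebra_simps)
      also have "\<dots> = e / 4"
        using n2 by (simp only: \<delta>_def mult.commute[of "(real n)\<^sup>2 + 1"]) (rule cancel)
      finally show "cmod (\<phi> a) \<le> e / 2"
        using quasi_state_le_unit_sandwich[OF h Q, of a n] 1 by linarith
    qed (use e in simp)
    then show "sup_seminorm K a < e" using e by simp
  qed
qed

lemma quasi_state_sandwich_le:
  assumes "\<phi> \<in> quasi_states"
  shows "cmod (\<phi> (star h * b * h)) \<le> norm b * Re (\<phi> (star h * h))"
proof (rule power2_le_imp_le)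
  note F = positive_unital_extension(1)[OF assms]
  have pos: "positive_functional \<phi>" using assms by (simp add: quasi_states_def)
  have "(cmod (\<phi> (star h * b * h)))\<^sup>2 \<le> Re (\<phi> (star h * h)) * Re (\<phi> (star (b * h) * (b * h)))"
    using positive_functional_Cauchy_Schwarz[OF pos, of h "b * h"] by (simp add: mult.assoc)
  also have "Re (\<phi> (star (b * h) * (b * h))) \<le> (norm b)\<^sup>2 * Re (\<phi> (star h * h))"
    using positive_functional_sandwich_le[OF F, of "unitize h" "unitize b"]
    by (simp add: star_mult mult.assoc flip: unitize_simps)
  then have "Re (\<phi> (star h * h)) * Re (\<phi> (star (b * h) * (b * h))) \<le>
      Re (\<phi> (star h * h)) * ((norm b)\<^sup>2 * Re (\<phi> (star h * h)))"
    by (rule mult_left_mono) (rule positive_functional_Re[OF pos])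
  finally show "(cmod (\<phi> (star h * b * h)))\<^sup>2 \<le> (norm b * Re (\<phi> (star h * h)))\<^sup>2"
    by (simp add: power2_eq_square mult_ac)
  show "0 \<le> norm b * Re (\<phi> (star h * h))" using positive_functional_Re[OF pos] by simp
qed

text \<open>
  The norm is at most \<open>1\<close> by the preceding inequality. It is not smaller, because the values
  at an approximate left unit for \<open>h\<close> tend to \<open>1\<close>.
\<close>

lemma compressed_state:
  assumes \<phi>: "\<phi> \<in> quasi_states" and nz: "Re (\<phi> (star h * h)) > 0"
  shows "(\<lambda>b. \<phi> (star h * b * h) / of_real (Re (\<phi> (star h * h)))) \<in> states"
proof -
  define r where "r = Re (\<phi> (star h * h))"
  define \<psi> where "\<psi> b = \<phi> (star h * b * h) / of_real r" for b
  have r: "r > 0" using nz by (simp add: r_def)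
  have pos: "positive_functional \<phi>" using \<phi> by (simp add: quasi_states_def)
  note bl\<phi> = quasi_state_bounded_linear[OF \<phi>]
  have le: "cmod (\<psi> b) \<le> norm b" for b
    using quasi_state_sandwich_le[OF \<phi>, of h b] r by (simp add: \<psi>_def norm_divide pos_divide_le_eq flip: r_def)
  have scale: "\<psi> (c *\<^sub>C b) = c * \<psi> b" for c b
    by (simp add: \<psi>_def mult_scaleC_left mult_scaleC_right positive_functional_linear[OF pos])
  have bl: "bounded_linear \<psi>"
    by (rule bounded_linear_intro[of _ 1])
      (simp_all add: le scale scaleR_scaleC scaleR_conv_of_real, simp add: \<psi>_def algebra_simps
        positive_functional_linear[OF pos] add_divide_distrib)
  have posi: "0 \<le> \<psi> (star x * x)" for x
  proof -
    have "star h * (star x * x) * h = star (x * h) * (x * h)" by (simp add: star_mult mult.assoc)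
    then show ?thesis
      using positive_functional_Re[OF pos, of "x * h"] positive_functional_Im[OF pos, of "x * h"] r
      by (simp add: \<psi>_def less_eq_complex_def)
  qed
  have "onorm \<psi> \<le> 1" by (rule onorm_bound) (simp_all add: le)
  moreover have "1 \<le> onorm \<psi>"
  proof -
    obtain e where e: "\<And>n. norm (e n) \<le> 1" "(\<lambda>n. e n * h) \<longlonglongrightarrow> h"
      using approximate_left_unit by blast
    have "(\<lambda>n. Re (\<phi> (star h * (e n * h)))) \<longlonglongrightarrow> Re (\<phi> (star h * h))"
      by (intro tendsto_intros bounded_linear.tendsto[OF bl\<phi>] e)
    then have "(\<lambda>n. Re (\<phi> (star h * (e n * h))) / r) \<longlonglongrightarrow> r / r"
      unfolding r_def[symmetric] using r by (intro tendsto_intros) auto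
    then have lim: "(\<lambda>n. Re (\<psi> (e n))) \<longlonglongrightarrow> 1"
      using r by (simp add: \<psi>_def mult.assoc)
    have "Re (\<psi> (e n)) \<le> onorm \<psi>" for n
    proof -
      have "Re (\<psi> (e n)) \<le> cmod (\<psi> (e n))" by (rule complex_Re_le_cmod)
      also have "\<dots> \<le> onorm \<psi> * norm (e n)" by (rule onorm[OF bl])
      also have "\<dots> \<le> onorm \<psi>" using e(1)[of n] onorm_pos_le[OF bl] by (simp add: mult_left_le)
      finally show ?thesis .
    qed
    with lim show ?thesis by (intro LIMSEQ_le_const2) auto
  qed
  ultimately have "\<psi> \<in> states" using bl scale posi by (simp add: states_def)
  then show ?thesis by (simp add: \<psi>_def[abs_def] r_def)
qed

text \<open>
  For self-adjoint elements the quasi-states attain the norm. For the compressions of the real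
  and imaginary parts of \<open>a\<close>, the values of a quasi-state are the real and imaginary parts of
  its value at \<open>h a h\<close>.
\<close>

lemma norm_le_if_quasi_states_le:
  fixes a h :: "'a::cstar_algebra"
  assumes h: "star h = h" and le: "\<And>\<phi>. \<phi> \<in> quasi_states \<Longrightarrow> cmod (\<phi> (h * a * h)) \<le> r"
  shows "norm (h * a * h) \<le> 2 * r"
proof -
  obtain c d where c: "star c = c" and d: "star d = d" and a: "a = c + \<i> *\<^sub>C d"
    by (rule cartesian_decomposition)
  have sc: "star (h * c * h) = h * c * h" and sd: "star (h * d * h) = h * d * h"
    by (simp_all add: star_mult h c d mult.assoc)
  have split: "h * a * h = h * c * h + \<i> *\<^sub>C (h * d * h)"
    by (simp add: a algebra_simps mult_scaleC_left mult_scaleC_right)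
  have parts: "cmod (\<phi> (h * c * h)) \<le> r \<and> cmod (\<phi> (h * d * h)) \<le> r" if \<phi>: "\<phi> \<in> quasi_states" for \<phi>
  proof -
    have pos: "positive_functional \<phi>" using \<phi> by (simp add: quasi_states_def)
    have eq: "\<phi> (h * a * h) = \<phi> (h * c * h) + \<i> * \<phi> (h * d * h)"
      unfolding split by (simp add: positive_functional_linear[OF pos])
    have re: "Im (\<phi> (h * c * h)) = 0" "Im (\<phi> (h * d * h)) = 0"
      using quasi_state_star[OF \<phi>, of "h * c * h"] quasi_state_star[OF \<phi>, of "h * d * h"]
      by (simp_all add: sc sd complex_eq_iff)
    have "\<bar>Re (\<phi> (h * a * h))\<bar> \<le> r" "\<bar>Im (\<phi> (h * a * h))\<bar> \<le> r"
      using le[OF \<phi>] abs_Re_le_cmod abs_Im_le_cmod order_trans by blast+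
    then show ?thesis using re by (simp add: eq cmod_def)
  qed
  have "norm (h * c * h) \<le> r"
    using exists_norming_quasi_state[OF sc] parts order_trans by blast
  moreover have "norm (h * d * h) \<le> r"
    using exists_norming_quasi_state[OF sd] parts order_trans by blast
  ultimately show ?thesis
    unfolding split using norm_triangle_ineq[of "h * c * h" "\<i> *\<^sub>C (h * d * h)"] by (simp add: norm_scaleC)
qed

text \<open>
  The set \<open>K\<close> consists of the normalized compressions of the quasi-states with \<open>\<phi>(h\<^sup>2) \<ge> \<epsilon>\<close>; it
  is compact as a continuous image of a closed part of the compact set of quasi-states. The
  choice of \<open>\<epsilon>\<close> takes care of the remaining quasi-states.
\<close>

lemma compression_small_if_sup_seminorm_small:
  fixes h :: "'a::cstar_algebra"
  assumes h: "star h = h" and e: "e > 0" and M: "M \<ge> 0"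
  obtains K \<delta> where "compactin state_space K" "\<delta> > 0"
    "\<And>a. norm a \<le> M \<Longrightarrow> sup_seminorm K a < \<delta> \<Longrightarrow> norm (h * a * h) < e"
proof -
  define \<epsilon> where "\<epsilon> = e / (4 * (M + 1))"
  define \<delta> where "\<delta> = e / (4 * ((norm h)\<^sup>2 + 1))"
  define Q where "Q = quasi_states \<inter> {\<phi>::'a \<Rightarrow> complex. \<epsilon> \<le> Re (\<phi> (star h * h))}"
  define T where "T \<phi> = (\<lambda>b. \<phi> (star h * b * h) / of_real (Re (\<phi> (star h * h))))" for \<phi> :: "'a \<Rightarrow> complex"
  have \<epsilon>: "\<epsilon> > 0" using e M by (simp add: \<epsilon>_def)
  have h2: "(norm h)\<^sup>2 + 1 > 0" by (simp add: add_nonneg_pos)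
  have \<delta>: "\<delta> > 0" using e h2 by (simp add: \<delta>_def)
  have cancel: "N > 0 \<Longrightarrow> e / (4 * N) * N = e / 4" for N :: real by simp
  have "compact Q"
    unfolding Q_def by (intro compact_Int_closed compact_quasi_states closed_Collect_le continuous_intros)
  moreover have "continuous_on Q T"
    unfolding T_def using \<epsilon> by (intro continuous_intros) (auto simp: Q_def)
  ultimately have "compact (T ` Q)" by (rule compact_continuous_image[rotated])
  moreover have TQ: "T ` Q \<subseteq> states"
    using compressed_state[of _ h] \<epsilon> by (auto simp: Q_def T_def)
  ultimately have K: "compactin state_space (T ` Q)" by (simp add: compactin_state_space)
  show thesis
  proof (rule that[OF K \<delta>])
    fix a assume a: "norm a \<le> M" "sup_seminorm (T ` Q) a < \<delta>"
    have "norm (h * a * h) \<le> 2 * (e / 4)"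
    proof (rule norm_le_if_quasi_states_le[OF h])
      fix \<phi> :: "'a \<Rightarrow> complex" assume \<phi>: "\<phi> \<in> quasi_states"
      define r where "r = Re (\<phi> (star h * h))"
      have pos: "positive_functional \<phi>" using \<phi> by (simp add: quasi_states_def)
      have r0: "0 \<le> r" unfolding r_def by (rule positive_functional_Re[OF pos])
      show "cmod (\<phi> (h * a * h)) \<le> e / 4"
      proof (cases "r < \<epsilon>")
        case True
        have "cmod (\<phi> (h * a * h)) \<le> norm a * r"
          using quasi_state_sandwich_le[OF \<phi>, of h a] by (simp add: h r_def)
        also have "\<dots> \<le> M * \<epsilon>" using a r0 True M by (intro mult_mono) simp_all
        also have "\<dots> \<le> e / 4" using e M by (simp add: \<epsilon>_def field_simps)
        finally show ?thesis .
      next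
        case False
        then have r: "r > 0" using \<epsilon> by simp
        have "T \<phi> \<in> T ` Q" using \<phi> False by (intro imageI) (simp add: Q_def r_def)
        from sup_seminorm_upper[OF TQ this, of a] a(2) have "cmod (T \<phi> a) \<le> \<delta>" by simp
        moreover have "cmod (\<phi> (h * a * h)) = cmod (T \<phi> a) * r"
          using r by (simp add: T_def norm_divide h r_def)
        ultimately have "cmod (\<phi> (h * a * h)) \<le> \<delta> * r" using r by (simp add: mult_right_mono)
        also have "r \<le> cmod (\<phi> (star h * h))" unfolding r_def by (rule complex_Re_le_cmod)
        also have "\<dots> \<le> (norm h)\<^sup>2" using \<phi> by (simp add: quasi_states_def flip: cstar_identity)
        also have "\<delta> * (norm h)\<^sup>2 \<le> \<delta> * ((norm h)\<^sup>2 + 1)" using \<delta> by simp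
        also have "\<delta> * ((norm h)\<^sup>2 + 1) = e / 4"
          using h2 by (simp only: \<delta>_def) (rule cancel)
        finally show ?thesis using \<delta> by simp
      qed
    qed
    then show "norm (h * a * h) < e" using e by simp
  qed
qed

text \<open>
  If \<open>h a h = 0\<close>, the estimate of \<open>\<phi>(a)\<close> by the compression leaves only terms that tend to
  \<open>0\<close>, so all states vanish at \<open>a\<close>; hence so do all quasi-states, and these separate points.
\<close>

lemma compression_zero_imp_zero:
  fixes h :: "'a::cstar_algebra"
  assumes sp: "strictly_positive h" and z: "h * a * h = 0"
  shows "a = 0"
proof -
  have h: "positive_element h" using sp by (simp add: strictly_positive_def)
  have state: "\<phi> a = 0" if \<phi>: "\<phi> \<in> states" for \<phi>
  proof -
    let ?d = "\<lambda>n. Re (unital_extension \<phi> (unit_defect h n))"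
    have "cmod (\<phi> a) \<le> 2 * sqrt (?d n) * norm a" for n
      using quasi_state_le_unit_sandwich[OF h state_imp_quasi_state[OF \<phi>], of a n] by (simp add: z)
    moreover have "(\<lambda>n. 2 * sqrt (?d n) * norm a) \<longlonglongrightarrow> 2 * sqrt 0 * norm a"
      by (intro tendsto_intros unit_defect_tendsto_zero[OF h sp \<phi>])
    ultimately have "cmod (\<phi> a) \<le> 0" by (intro LIMSEQ_le_const) auto
    then show ?thesis by simp
  qed
  have quasi: "\<phi> a = 0" if \<phi>: "\<phi> \<in> quasi_states" for \<phi>
  proof (rule ccontr)
    assume nz: "\<phi> a \<noteq> 0"
    have "onorm \<phi> > 0" using onorm_pos_lt[OF quasi_state_bounded_linear[OF \<phi>]] nz by blast
    then show False using state[OF normalized_state[OF \<phi> nz]] nz by simp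
  qed
  obtain c d where c: "star c = c" and d: "star d = d" and a: "a = c + \<i> *\<^sub>C d"
    by (rule cartesian_decomposition)
  have "\<phi> c = 0 \<and> \<phi> d = 0" if \<phi>: "\<phi> \<in> quasi_states" for \<phi>
  proof -
    have pos: "positive_functional \<phi>" using \<phi> by (simp add: quasi_states_def)
    have "\<phi> c + \<i> * \<phi> d = 0" using quasi[OF \<phi>] by (simp add: a positive_functional_linear[OF pos])
    moreover have "Im (\<phi> c) = 0" "Im (\<phi> d) = 0"
      using quasi_state_star[OF \<phi>, of c] quasi_state_star[OF \<phi>, of d] by (simp_all add: c d complex_eq_iff)
    ultimately show ?thesis by (simp add: complex_eq_iff)
  qed
  then have "c = 0" "d = 0"
    using exists_norming_quasi_state[OF c] exists_norming_quasi_state[OF d] by force+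
  then show ?thesis by (simp add: a)
qed

text \<open>
  The two comparison lemmas translate smallness of \<open>\<parallel>h a h\<parallel>\<close> into smallness of one seminorm at
  a time and back, for \<open>a\<close> in a fixed ball.
\<close>

theorem wu_convergence_iff:
  fixes h :: "'a::cstar_algebra" and f :: "'i \<Rightarrow> 'a"
  assumes sp: "strictly_positive h" and M: "eventually (\<lambda>i. norm (f i) \<le> M) F"
  shows "limitin wu_topology f 0 F \<longleftrightarrow> ((\<lambda>i. norm (h * f i * h)) \<longlongrightarrow> 0) F"
proof -
  have M': "eventually (\<lambda>i. norm (f i) \<le> \<bar>M\<bar>) F"
    using M by (rule eventually_mono) simp
  obtain b where "h = star b * b" using sp by (auto simp: strictly_positive_def positive_element_def)
  then have sh: "star h = h" by (simp add: star_simps)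
  have tend: "((\<lambda>i. norm (h * f i * h)) \<longlongrightarrow> 0) F \<longleftrightarrow> (\<forall>e>0. eventually (\<lambda>i. norm (h * f i * h) < e) F)"
    by (simp add: tendsto_iff)
  show ?thesis
    unfolding tend limitin_wu_topology_zero_iff
  proof (intro iffI allI impI)
    fix e :: real assume *: "\<forall>(K :: ('a \<Rightarrow> complex) set) e. compactin state_space K \<longrightarrow> 0 < e \<longrightarrow> (\<forall>\<^sub>F i in F. sup_seminorm K (f i) < e)"
      and e: "e > 0"
    obtain K and \<delta> :: real where K: "compactin state_space K" "\<delta> > 0"
      "\<And>a. norm a \<le> \<bar>M\<bar> \<Longrightarrow> sup_seminorm K a < \<delta> \<Longrightarrow> norm (h * a * h) < e"
      using compression_small_if_sup_seminorm_small[OF sh e abs_ge_zero] by metis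
    with * have "\<forall>\<^sub>F i in F. sup_seminorm K (f i) < \<delta>" by blast
    with M' show "\<forall>\<^sub>F i in F. norm (h * f i * h) < e" by eventually_elim (rule K(3))
  next
    fix K :: "('a \<Rightarrow> complex) set" and e :: real assume *: "\<forall>e>0. \<forall>\<^sub>F i in F. norm (h * f i * h) < e"
      and K: "compactin state_space K" and e: "e > 0"
    obtain \<delta> where \<delta>: "\<delta> > 0" "\<And>a. norm a \<le> \<bar>M\<bar> \<Longrightarrow> norm (h * a * h) < \<delta> \<Longrightarrow> sup_seminorm K a < e"
      using sup_seminorm_small_if_compression_small[OF sp K e abs_ge_zero] by metis
    with * have "\<forall>\<^sub>F i in F. norm (h * f i * h) < \<delta>" by blast
    with M' show "\<forall>\<^sub>F i in F. sup_seminorm K (f i) < e" by eventually_elim (rule \<delta>(2))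
  qed
qed

lemma Metric_space_compression:
  fixes h :: "'a::cstar_algebra"
  assumes sp: "strictly_positive h"
  shows "Metric_space B (\<lambda>a b. norm (h * (b - a) * h))"
proof
  fix x y z :: 'a
  show "0 \<le> norm (h * (y - x) * h)" by simp
  show "norm (h * (y - x) * h) = norm (h * (x - y) * h)"
    by (subst norm_minus_cancel[symmetric]) (simp add: algebra_simps)
  show "norm (h * (y - x) * h) = 0 \<longleftrightarrow> x = y"
    using compression_zero_imp_zero[OF sp, of "y - x"] by auto
  have "h * (z - x) * h = h * (y - x) * h + h * (z - y) * h" by (simp add: algebra_simps)
  then show "norm (h * (z - x) * h) \<le> norm (h * (y - x) * h) + norm (h * (z - y) * h)"
    by (simp add: norm_triangle_ineq)
qed

text \<open>
  The comparison lemmas apply to the differences \<open>y - x\<close> of points of \<open>B\<close>, whose norms are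
  bounded because \<open>B\<close> is. So every seminorm ball around a point of \<open>B\<close> contains, within \<open>B\<close>, a
  metric ball, and conversely.
\<close>

theorem wu_metrizable_on_bounded:
  fixes h :: "'a::cstar_algebra"
  assumes sp: "strictly_positive h" and B: "bounded B"
  shows "Metric_space.mtopology B (\<lambda>a b. norm (h * (b - a) * h)) = subtopology wu_topology B"
proof -
  interpret Metric_space B "\<lambda>a b. norm (h * (b - a) * h)" by (rule Metric_space_compression[OF sp])
  obtain b where "h = star b * b" using sp by (auto simp: strictly_positive_def positive_element_def)
  then have sh: "star h = h" by (simp add: star_simps)
  obtain M where M: "M \<ge> 0" "\<And>x y. x \<in> B \<Longrightarrow> y \<in> B \<Longrightarrow> norm (y - x) \<le> M"
  proof -
    obtain R where R: "\<And>x. x \<in> B \<Longrightarrow> norm x \<le> R" using B by (auto simp: bounded_iff)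
    have "norm (y - x) \<le> 2 * \<bar>R\<bar>" if "x \<in> B" "y \<in> B" for x y
      using R[OF that(1)] R[OF that(2)] norm_triangle_ineq4[of y x] by linarith
    then show thesis using that[of "2 * \<bar>R\<bar>"] by simp
  qed
  have "openin mtopology U \<longleftrightarrow> openin (subtopology wu_topology B) U" for U
  proof
    assume "openin mtopology U"
    then have UB: "U \<subseteq> B" and U: "\<And>x. x \<in> U \<Longrightarrow> \<exists>r>0. mball x r \<subseteq> U" by (auto simp: openin_mtopology)
    let ?T = "\<Union>{T. openin wu_topology T \<and> T \<inter> B \<subseteq> U}"
    have "U \<subseteq> ?T"
    proof
      fix x assume x: "x \<in> U"
      then obtain r where r: "r > 0" "mball x r \<subseteq> U" using U by blast
      obtain K \<delta> where K: "compactin state_space K" "\<delta> > 0"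
        "\<And>a. norm a \<le> M \<Longrightarrow> sup_seminorm K a < \<delta> \<Longrightarrow> norm (h * a * h) < r"
        using compression_small_if_sup_seminorm_small[OF sh r(1) M(1)] by metis
      have "{y. sup_seminorm K (y - x) < \<delta>} \<inter> B \<subseteq> mball x r"
        using K(3) M(2) x UB by (auto simp: mball_def)
      moreover have "x \<in> {y. sup_seminorm K (y - x) < \<delta>}"
        using K by (simp add: sup_seminorm_zero compactin_state_space)
      ultimately show "x \<in> ?T" using openin_wu_ball[OF K(1,2), of x] r(2) by blast
    qed
    then have "U = ?T \<inter> B" using UB by blast
    moreover have "openin wu_topology ?T" by (rule openin_Union) blast
    ultimately show "openin (subtopology wu_topology B) U" by (auto simp: openin_subtopology)
  next
    assume "openin (subtopology wu_topology B) U"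
    then obtain T where T: "openin wu_topology T" and U: "U = T \<inter> B" by (auto simp: openin_subtopology)
    show "openin mtopology U"
      unfolding openin_mtopology
    proof (intro conjI allI impI)
      show "U \<subseteq> B" using U by blast
      fix x assume x: "x \<in> U"
      then obtain K e where K: "compactin state_space K" "e > 0" "{y. sup_seminorm K (y - x) < e} \<subseteq> T"
        using T U unfolding openin_wu_topology_iff by blast
      obtain \<delta> where \<delta>: "\<delta> > 0" "\<And>a. norm a \<le> M \<Longrightarrow> norm (h * a * h) < \<delta> \<Longrightarrow> sup_seminorm K a < e"
        using sup_seminorm_small_if_compression_small[OF sp K(1,2) M(1)] by metis
      have "mball x \<delta> \<subseteq> U"
        using \<delta>(2) M(2) K(3) U by (auto simp: mball_def)
      with \<delta>(1) show "\<exists>r>0. mball x r \<subseteq> U" by blast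
    qed
  qed
  then show ?thesis by (simp add: topology_eq)
qed

theorem theorem3p17:
  fixes h :: "'a::cstar_algebra"
  assumes "separable_space (euclidean :: 'a topology)"
    and "strictly_positive h"
  shows "(\<forall>(\<Lambda> :: 'l set) le (a :: 'l \<Rightarrow> 'a). directed_set \<Lambda> le \<longrightarrow> bounded (a ` \<Lambda>) \<longrightarrow>
            (limitin wu_topology a 0 (net_filter \<Lambda> le) \<longleftrightarrow>
             ((\<lambda>l. norm (h * a l * h)) \<longlongrightarrow> 0) (net_filter \<Lambda> le))) \<and>
         (\<forall>B :: 'a set. bounded B \<longrightarrow>
            Metric_space B (\<lambda>a b. norm (h * (b - a) * h)) \<and>
            Metric_space.mtopology B (\<lambda>a b. norm (h * (b - a) * h)) = subtopology wu_topology B)"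
proof (intro conjI allI impI)
  fix \<Lambda> :: "'l set" and le and a :: "'l \<Rightarrow> 'a"
  assume dir: "directed_set \<Lambda> le" and bdd: "bounded (a ` \<Lambda>)"
  obtain M where M: "\<And>l. l \<in> \<Lambda> \<Longrightarrow> norm (a l) \<le> M" using bdd by (auto simp: bounded_iff)
  have "eventually (\<lambda>l. norm (a l) \<le> M) (net_filter \<Lambda> le)"
    using dir M unfolding eventually_net_filter[OF dir] by (auto simp: directed_set_def)
  then show "limitin wu_topology a 0 (net_filter \<Lambda> le) \<longleftrightarrow>
      ((\<lambda>l. norm (h * a l * h)) \<longlongrightarrow> 0) (net_filter \<Lambda> le)"
    by (rule wu_convergence_iff[OF assms(2)])
next
  fix B :: "'a set" assume "bounded B"
  then show "Metric_space B (\<lambda>a b. norm (h * (b - a) * h))"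
    and "Metric_space.mtopology B (\<lambda>a b. norm (h * (b - a) * h)) = subtopology wu_topology B"
    using assms(2) by (simp_all add: Metric_space_compression wu_metrizable_on_bounded)
qed

end
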